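(* For every $k\in\mathbb N$, $\mathsf{Loop}[\log^k n,\ \mathsf{poly}(n),\ 1]=\mathsf{AC}^k$ and $\mathsf{Loop}[\log^k n,\ \mathsf{poly}(n),\ \log n]=\mathsf{TC}^k$.
   Context: $\mathsf{Loop}[T(n),d(n),s(n)]$ is the set of languages $\mathcal L:\{0,1\}^*\to\{0,1\}$ such that for every $n$ there is a deterministic Looped Transformer $M_n$ (non-uniform: a different model for each $n$) with embedding size $O(d(n))$ and $O(s(n))$ bits of precision whose final output token after $O(T(n))$ loop iterations equals $\mathcal L(x)$ for all $x\in\{0,1\}^n$. Looped Transformer: embeds the input position-wise, applies a fixed block of constantly many residual layers (non-causal multi-head softmax self-attention, then position-wise ReLU feedforward $W_2\mathrm{ReLU}(W_1z+b)$) repeatedly, and outputs $\arg\max$ of a linear output map at the last position. Finite precision: numbers with a sign bit and $s$-bit mantissa (no exponent), each arithmetic operation rounded to the nearest representable number, multi-term sums computed left to right with rounding after each addition. $\mathsf{AC}^k$ (resp. $\mathsf{TC}^k$, $\mathsf{NC}^k$): languages decided by non-uniform families of Boolean circuits of size $\mathsf{poly}(n)$ and depth $O(\log^k n)$ with unbounded fan-in AND/OR and NOT gates (resp. unbounded fan-in threshold/majority gates; bounded fan-in Boolean gates). *)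

theory Defs
  imports Complex_Main
begin

text \<open>log^k n, base 2; for n = 0 we use log 1 = 0 (only relevant for the empty input).\<close>
definition logpow :: "nat \<Rightarrow> nat \<Rightarrow> real" where
  "logpow k n = (log 2 (real (max 1 n))) ^ k"

datatype gate = GAnd | GOr | GNot | GThr nat
datatype wire = Inp nat | Gt nat

type_synonym circuit = "(gate \<times> wire list) list"

definition circ_wf :: "nat \<Rightarrow> circuit \<Rightarrow> bool" where
  "circ_wf n C \<longleftrightarrow> C \<noteq> [] \<and>
     (\<forall>i<length C. (\<forall>w\<in>set (snd (C!i)). (case w of Inp j \<Rightarrow> j < n | Gt m \<Rightarrow> m < i))
                   \<and> (fst (C!i) = GNot \<longrightarrow> length (snd (C!i)) = 1))"

definition wire_val :: "bool list \<Rightarrow> bool list \<Rightarrow> wire \<Rightarrow> bool" where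
  "wire_val x vs w = (case w of Inp j \<Rightarrow> x ! j | Gt m \<Rightarrow> vs ! m)"

definition gate_val :: "gate \<Rightarrow> bool list \<Rightarrow> bool" where
  "gate_val g bs = (case g of GAnd \<Rightarrow> list_all id bs | GOr \<Rightarrow> list_ex id bs
                     | GNot \<Rightarrow> \<not> hd bs | GThr t \<Rightarrow> t \<le> length (filter id bs))"

definition circ_vals :: "bool list \<Rightarrow> circuit \<Rightarrow> bool list" where
  "circ_vals x C = foldl (\<lambda>vs gw. vs @ [gate_val (fst gw) (map (wire_val x vs) (snd gw))]) [] C"

definition circ_out :: "bool list \<Rightarrow> circuit \<Rightarrow> bool" where
  "circ_out x C = last (circ_vals x C)"

definition wire_depth :: "nat list \<Rightarrow> wire \<Rightarrow> nat" where
  "wire_depth ds w = (case w of Inp _ \<Rightarrow> 0 | Gt m \<Rightarrow> ds ! m)"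

definition gate_depths :: "circuit \<Rightarrow> nat list" where
  "gate_depths C = foldl (\<lambda>ds gw. ds @ [1 + Max (insert 0 (set (map (wire_depth ds) (snd gw))))]) [] C"

definition circ_depth :: "circuit \<Rightarrow> nat" where
  "circ_depth C = Max (insert 0 (set (gate_depths C)))"

definition circ_size :: "circuit \<Rightarrow> nat" where
  "circ_size C = (\<Sum>gw\<leftarrow>C. 1 + length (snd gw))"

definition ac_gate :: "gate \<Rightarrow> bool" where
  "ac_gate g = (case g of GThr _ \<Rightarrow> False | _ \<Rightarrow> True)"

definition AC :: "nat \<Rightarrow> (bool list \<Rightarrow> bool) set" where
  "AC k = {L. \<exists>c::nat. \<forall>n. \<exists>C. circ_wf n C \<and> (\<forall>gw\<in>set C. ac_gate (fst gw))
       \<and> real (circ_size C) \<le> real c * real n ^ c + real c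
       \<and> real (circ_depth C) \<le> real c * logpow k n + real c
       \<and> (\<forall>x. length x = n \<longrightarrow> circ_out x C = L x)}"

definition TC :: "nat \<Rightarrow> (bool list \<Rightarrow> bool) set" where
  "TC k = {L. \<exists>c::nat. \<forall>n. \<exists>C. circ_wf n C
       \<and> real (circ_size C) \<le> real c * real n ^ c + real c
       \<and> real (circ_depth C) \<le> real c * logpow k n + real c
       \<and> (\<forall>x. length x = n \<longrightarrow> circ_out x C = L x)}"

text \<open>Precision p: sign bit and mantissa, no exponent; fixed point with p fractional bits and
  magnitude below 2^p, i.e. numbers k/2^p with |k| < 2^(2p).\<close>
definition fx :: "nat \<Rightarrow> real set" where
  "fx p = {of_int k / 2 ^ p | k. \<bar>k\<bar> < 2 ^ (2 * p)}"

definition rd :: "nat \<Rightarrow> real \<Rightarrow> real" where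
  "rd p x = (let M = (2::int) ^ (2 * p) - 1; k = \<lfloor>x * 2 ^ p + 1 / 2\<rfloor>
             in of_int (max (- M) (min M k)) / 2 ^ p)"

definition fadd :: "nat \<Rightarrow> real \<Rightarrow> real \<Rightarrow> real" where "fadd p a b = rd p (a + b)"
definition fmul :: "nat \<Rightarrow> real \<Rightarrow> real \<Rightarrow> real" where "fmul p a b = rd p (a * b)"

definition fsum :: "nat \<Rightarrow> real list \<Rightarrow> real" where "fsum p xs = foldl (fadd p) 0 xs"
definition fdot :: "nat \<Rightarrow> real list \<Rightarrow> real list \<Rightarrow> real" where
  "fdot p u v = fsum p (map2 (fmul p) u v)"
definition fmv :: "nat \<Rightarrow> real list list \<Rightarrow> real list \<Rightarrow> real list" where
  "fmv p W z = map (\<lambda>r. fdot p r z) W"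
definition fvadd :: "nat \<Rightarrow> real list \<Rightarrow> real list \<Rightarrow> real list" where
  "fvadd p u v = map2 (fadd p) u v"
definition fvsum :: "nat \<Rightarrow> nat \<Rightarrow> real list list \<Rightarrow> real list" where
  "fvsum p d vs = foldl (fvadd p) (replicate d 0) vs"

record head = hQ :: "real list list" hK :: "real list list" hV :: "real list list"
record layer = heads :: "head list" W1 :: "real list list" b1 :: "real list" W2 :: "real list list"

definition head_out :: "nat \<Rightarrow> head \<Rightarrow> real list list \<Rightarrow> nat \<Rightarrow> real list" where
  "head_out p h zs i = (let q = fmv p (hQ h) (zs ! i);
      es = map (\<lambda>zj. rd p (exp (fdot p q (fmv p (hK h) zj)))) zs;
      Z = fsum p es;
      ws = map (\<lambda>e. rd p (e / Z)) es
    in fvsum p (length (zs ! i)) (map2 (\<lambda>w zj. map (fmul p w) (fmv p (hV h) zj)) ws zs))"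

definition layer_apply :: "nat \<Rightarrow> layer \<Rightarrow> real list list \<Rightarrow> real list list" where
  "layer_apply p L zs = (let ys = map (\<lambda>i. fvadd p (zs ! i)
        (fvsum p (length (zs ! i)) (map (\<lambda>h. head_out p h zs i) (heads L)))) [0..<length zs]
     in map (\<lambda>y. fvadd p y (fmv p (W2 L) (map (max 0) (fvadd p (fmv p (W1 L) y) (b1 L))))) ys)"

definition block_apply :: "nat \<Rightarrow> layer list \<Rightarrow> real list list \<Rightarrow> real list list" where
  "block_apply p Ls zs = foldl (\<lambda>zs L. layer_apply p L zs) zs Ls"

record looped_tf =
  emb :: "nat \<Rightarrow> bool \<Rightarrow> real list"
  blk :: "layer list"
  wo0 :: "real list"
  wo1 :: "real list"
  dim :: nat
  prec :: nat
  iters :: nat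

text \<open>Output: argmax over the two classes at the last position (ties give 0).\<close>
definition lt_out :: "looped_tf \<Rightarrow> bool list \<Rightarrow> bool" where
  "lt_out M x = (let p = prec M;
      z0 = map (\<lambda>i. emb M i (x ! i)) [0..<length x];
      zl = last ((block_apply p (blk M) ^^ iters M) z0)
    in fdot p (wo0 M) zl < fdot p (wo1 M) zl)"

definition vec_ok :: "nat \<Rightarrow> nat \<Rightarrow> real list \<Rightarrow> bool" where
  "vec_ok p d v \<longleftrightarrow> length v = d \<and> set v \<subseteq> fx p"
definition mat_ok :: "nat \<Rightarrow> nat \<Rightarrow> nat \<Rightarrow> real list list \<Rightarrow> bool" where
  "mat_ok p r col W \<longleftrightarrow> length W = r \<and> (\<forall>row\<in>set W. vec_ok p col row)"
definition head_ok :: "nat \<Rightarrow> nat \<Rightarrow> head \<Rightarrow> bool" where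
  "head_ok p d h \<longleftrightarrow> (\<exists>dh\<le>d. mat_ok p dh d (hQ h) \<and> mat_ok p dh d (hK h)) \<and> mat_ok p d d (hV h)"
definition layer_ok :: "nat \<Rightarrow> nat \<Rightarrow> layer \<Rightarrow> bool" where
  "layer_ok p d L \<longleftrightarrow> (\<forall>h\<in>set (heads L). head_ok p d h) \<and>
     (\<exists>m\<le>d. mat_ok p m d (W1 L) \<and> vec_ok p m (b1 L) \<and> mat_ok p d m (W2 L))"
definition lt_ok :: "nat \<Rightarrow> looped_tf \<Rightarrow> bool" where
  "lt_ok n M \<longleftrightarrow> (\<forall>i<n. \<forall>b. vec_ok (prec M) (dim M) (emb M i b))
     \<and> (\<forall>L\<in>set (blk M). layer_ok (prec M) (dim M) L)
     \<and> vec_ok (prec M) (dim M) (wo0 M) \<and> vec_ok (prec M) (dim M) (wo1 M)"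

text \<open>Loop[T, d, s]; O(f) rendered as "at most c*f(n)+c" with c independent of n.
  The number of layers and heads per layer is bounded by a constant.\<close>
definition Loop :: "(nat \<Rightarrow> real) \<Rightarrow> (nat \<Rightarrow> real) \<Rightarrow> (nat \<Rightarrow> real) \<Rightarrow> (bool list \<Rightarrow> bool) set" where
  "Loop T d s = {L. \<exists>c::nat. \<forall>n\<ge>1. \<exists>M. lt_ok n M
       \<and> length (blk M) \<le> c \<and> (\<forall>La\<in>set (blk M). length (heads La) \<le> c)
       \<and> real (dim M) \<le> real c * d n + real c
       \<and> real (prec M) \<le> real c * s n + real c
       \<and> real (iters M) \<le> real c * T n + real c
       \<and> (\<forall>x. length x = n \<longrightarrow> lt_out M x = L x)}"

end

theory Submission
  imports Defs
begin

text \<open>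
Circuits to transformers: after one uniform attention step every position holds the whole input,
since a nonzero rounded attention weight times the largest number is at least 1. The feedforward
layer then updates all gates of the circuit in parallel: each gate and its negation is a node whose
next value is whether at most $\tau$ of its sources are true, which is the difference of two ReLUs,
$(\tau + 1 - s)^+ - (\tau - s)^+$. Two iterations settle one level of the circuit, and precision is
needed only to hold $\tau$: one bit for AND and OR, $\log n$ bits for thresholds.

Transformers to circuits: a number is encoded one-hot, so each operation on two numbers is a table
lookup by a formula of depth two and polynomial size. Summation with rounding is a walk on the
integers clamped at two barriers. With logarithmic precision its end point is read off from the
suffix sums, which threshold gates compare to constants. With constant precision it is a
cascade of boundedly many set/reset bits, one for each unit by which the lower barrier is raised, and AND
and OR gates find the last event that set or reset a bit. Hence a layer costs constant depth.
\<close>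

section \<open>Fixed-point arithmetic\<close>

text \<open>Two effects of the arithmetic shape the proof. Rounded attention does not deliver exact
  bits: a true input arrives as some number at least 1, to which the residual connection may add in
  every iteration. So raw inputs may feed only nodes with \<open>tau = 0\<close>, where every
  positive amount counts the same, and a failed test is known only through a one-sided bound. As "at
  most \<open>tau\<close> true sources" is antitone, values and negations must be carried side by
  side.

  Conversely, clamping makes addition non-associative, so a rounded sum is neither a balanced tree
  of additions nor one comparison of the exact sum; it is the run of a finite automaton. Constant
  depth with AND and OR gates forbids this automaton to count modulo anything; the set/reset bits
  are an explicit Krohn-Rhodes cascade for a group-free automaton.

  Formulas are expanded into trees only within one layer. Between layers the one-hot bits of the
  state are shared, as otherwise the size would be exponential in the number of iterations.\<close>

definition maxk :: "nat \<Rightarrow> int" where "maxk p = 2 ^ (2 * p) - 1"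

lemma maxk_nonneg [simp]: "0 \<le> maxk p"
  by (simp add: maxk_def)

lemma rd_eq: "rd p x = of_int (max (- maxk p) (min (maxk p) \<lfloor>x * 2 ^ p + 1 / 2\<rfloor>)) / 2 ^ p"
  by (simp add: rd_def Let_def maxk_def)

lemma fx_iff: "x \<in> fx p \<longleftrightarrow> (\<exists>k. \<bar>k\<bar> \<le> maxk p \<and> x = of_int k / 2 ^ p)"
  unfolding fx_def maxk_def by (auto; smt)

lemma rd_in_fx [simp]: "rd p x \<in> fx p"
  using maxk_nonneg[of p] unfolding fx_iff rd_eq
  by (intro exI[of _ "max (- maxk p) (min (maxk p) \<lfloor>x * 2 ^ p + 1 / 2\<rfloor>)"])
    (simp add: abs_le_iff)

lemma rd_mono: "x \<le> y \<Longrightarrow> rd p x \<le> rd p y"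
  unfolding rd_eq
  by (intro divide_right_mono of_int_le_iff[THEN iffD2] max.mono min.mono floor_mono) auto

text \<open>At multiples of \<open>1 / 2 ^ p\<close> only the clamping remains, so
  \<open>fadd\<close> on \<open>fx p\<close> is clamped integer addition. Only products,
  exponentials and quotients are really rounded.\<close>

lemma rd_of_int:
  "rd p (of_int k / 2 ^ p) = of_int (max (- maxk p) (min (maxk p) k)) / 2 ^ p"
proof -
  have "\<lfloor>(of_int k / 2 ^ p :: real) * 2 ^ p + 1 / 2\<rfloor> = k"
    by (simp add: floor_eq_iff)
  then show ?thesis unfolding rd_eq by simp
qed

lemma rd_id: "x \<in> fx p \<Longrightarrow> rd p x = x"
  unfolding fx_iff by (auto simp: rd_of_int)

lemma zero_in_fx [simp]: "0 \<in> fx p"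
  unfolding fx_iff by (intro exI[of _ 0]) simp

lemma uminus_in_fx: "x \<in> fx p \<Longrightarrow> - x \<in> fx p"
  unfolding fx_iff by (metis abs_minus_cancel minus_divide_left of_int_minus)

lemma int_in_fx:
  assumes "\<bar>k\<bar> < 2 ^ p" shows "of_int k \<in> fx p"
proof -
  have "\<bar>k * 2 ^ p\<bar> \<le> (2 ^ p - 1) * 2 ^ p"
    using assms by (simp add: abs_mult)
  also have "\<dots> \<le> maxk p"
    unfolding maxk_def mult_2 power_add by (simp add: algebra_simps)
  finally show ?thesis unfolding fx_iff by (intro exI[of _ "k * 2 ^ p"]) simp
qed

lemma nat_in_fx: "k < 2 ^ p \<Longrightarrow> real k \<in> fx p"
  using int_in_fx[of "int k" p] by (metis abs_of_nat of_int_of_nat_eq of_nat_less_numeral_power_cancel_iff)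

lemma rd_0 [simp]: "rd p 0 = 0"
  by (simp add: rd_id)

lemma fmul_0 [simp]: "fmul p 0 x = 0" "fmul p x 0 = 0"
  by (simp_all add: fmul_def)

lemma fmul_in_fx [simp]: "fmul p x y \<in> fx p" and fadd_in_fx [simp]: "fadd p x y \<in> fx p"
  by (simp_all add: fmul_def fadd_def)

lemma fadd_0 [simp]: "x \<in> fx p \<Longrightarrow> fadd p x 0 = x" "x \<in> fx p \<Longrightarrow> fadd p 0 x = x"
  by (simp_all add: fadd_def rd_id)

lemma foldl_fadd_in_fx: "a \<in> fx p \<Longrightarrow> foldl (fadd p) a xs \<in> fx p"
  by (induction xs arbitrary: a) auto

lemma fsum_in_fx [simp]: "fsum p xs \<in> fx p"
  by (simp add: fsum_def foldl_fadd_in_fx)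

lemma fdot_in_fx [simp]: "fdot p u v \<in> fx p"
  by (simp add: fdot_def)

lemma foldl_fadd_zeros:
  "a \<in> fx p \<Longrightarrow> (\<And>k. k \<in> set ks \<Longrightarrow> f k = 0) \<Longrightarrow> foldl (fadd p) a (map f ks) = a"
  by (induction ks arbitrary: a) auto

text \<open>Zero summands cause no rounding, so a single nonzero term does not feel the order of
  summation. This evaluates unit rows, and attention sums to which one position alone
  contributes.\<close>

lemma foldl_fadd_single:
  assumes "a \<in> fx p" "k0 \<in> set ks" "distinct ks" "\<And>k. k \<in> set ks \<Longrightarrow> k \<noteq> k0 \<Longrightarrow> f k = 0"
  shows "foldl (fadd p) a (map f ks) = fadd p a (f k0)"
  using assms
proof (induction ks arbitrary: a)
  case (Cons k ks)
  show ?case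
  proof (cases "k = k0")
    case True
    then show ?thesis using Cons.prems by (auto intro!: foldl_fadd_zeros)
  next
    case False
    then have "f k = 0" using Cons.prems by simp
    then show ?thesis using Cons False by simp
  qed
qed simp

lemma fsum_single:
  assumes "k0 < d" "f k0 \<in> fx p" "\<And>k. k < d \<Longrightarrow> k \<noteq> k0 \<Longrightarrow> f k = 0"
  shows "fsum p (map f [0..<d]) = f k0"
  unfolding fsum_def using assms by (subst foldl_fadd_single[of _ _ k0]) auto

lemma fsum_zeros: "(\<And>k. k < d \<Longrightarrow> f k = 0) \<Longrightarrow> fsum p (map f [0..<d]) = 0"
  unfolding fsum_def by (subst foldl_fadd_zeros) auto

lemma fdot_map:
  "length v = d \<Longrightarrow> fdot p (map f [0..<d]) v = fsum p (map (\<lambda>k. fmul p (f k) (v ! k)) [0..<d])"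
  unfolding fdot_def by (intro arg_cong[where f = "fsum p"] nth_equalityI) auto

lemma length_fvadd [simp]: "length (fvadd p u v) = min (length u) (length v)"
  by (simp add: fvadd_def)

lemma nth_fvadd: "j < length u \<Longrightarrow> j < length v \<Longrightarrow> fvadd p u v ! j = fadd p (u ! j) (v ! j)"
  by (simp add: fvadd_def)

lemma length_fmv [simp]: "length (fmv p W z) = length W"
  by (simp add: fmv_def)

lemma nth_fmv: "j < length W \<Longrightarrow> fmv p W z ! j = fdot p (W ! j) z"
  by (simp add: fmv_def)

lemma foldl_fvadd:
  assumes "length a = d" "\<And>v. v \<in> set vs \<Longrightarrow> length v = d"
  shows "length (foldl (fvadd p) a vs) = d"
    and "j < d \<Longrightarrow> foldl (fvadd p) a vs ! j = foldl (fadd p) (a ! j) (map (\<lambda>v. v ! j) vs)"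
  using assms
proof (induction vs arbitrary: a)
  case (Cons v vs)
  { case 1 then show ?case by (simp add: Cons.IH) }
  { case 2 then show ?case by (simp add: Cons.IH nth_fvadd) }
qed auto

lemma length_fvsum: "(\<And>v. v \<in> set vs \<Longrightarrow> length v = d) \<Longrightarrow> length (fvsum p d vs) = d"
  unfolding fvsum_def by (rule foldl_fvadd) auto

lemma nth_fvsum:
  "(\<And>v. v \<in> set vs \<Longrightarrow> length v = d) \<Longrightarrow> j < d \<Longrightarrow>
    fvsum p d vs ! j = fsum p (map (\<lambda>v. v ! j) vs)"
  unfolding fvsum_def fsum_def by (subst foldl_fvadd(2)[of _ d]) auto

section \<open>Threshold networks as looped transformers\<close>

lemma fx_le: "x \<in> fx p \<Longrightarrow> x \<le> 2 ^ p"
proof -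
  assume "x \<in> fx p"
  then obtain k where k: "k \<le> maxk p" "x = of_int k / 2 ^ p"
    by (fastforce simp: fx_iff)
  then have "real_of_int k \<le> of_int (2 ^ (2 * p))"
    by (subst of_int_le_iff) (simp add: maxk_def)
  then show ?thesis
    by (simp add: k divide_simps mult_2 power_add)
qed

lemma maxk_pos: "1 \<le> p \<Longrightarrow> 1 \<le> maxk p"
  using power_increasing[of 1 "2 * p" "2::int"] by (simp add: maxk_def)

text \<open>Clamping may stop the sum short of its true value, but not before \<open>- L\<close>:
  the bound is always an integer \<open>- min L m\<close>, which is representable because
  \<open>L < 2 ^ p\<close>, and rounding is monotone. The summands need not be integers.\<close>

lemma foldl_fadd_le:
  assumes "\<And>k. k \<in> set ks \<Longrightarrow> t k \<le> - real (T k)" "L < 2 ^ p"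
    "A \<le> max (- real L) (- real X)"
  shows "foldl (fadd p) A (map t ks) \<le> max (- real L) (- real (X + sum_list (map T ks)))"
  using assms(1,3)
proof (induction ks arbitrary: A X)
  case (Cons k ks)
  have "fadd p A (t k) \<le> rd p (max (- real L) (- real (X + T k)))"
    unfolding fadd_def using Cons.prems(1)[of k] Cons.prems(2) by (intro rd_mono) auto
  also have "max (- real L) (- real (X + T k)) = - real (min L (X + T k))"
    by (auto simp: min_def max_def)
  also have "rd p \<dots> = \<dots>"
    using assms(2) by (intro rd_id uminus_in_fx nat_in_fx) auto
  finally have "fadd p A (t k) \<le> max (- real L) (- real (X + T k))"
    by (auto simp: min_def max_def split: if_splits)
  from Cons.IH[OF _ this] Cons.prems(1) show ?case by (simp add: add.assoc)
qed simp

text \<open>All partial sums are integers of modulus below \<open>2 ^ p\<close>, so nothing is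
  rounded.\<close>

lemma foldl_fadd_exact:
  assumes "\<And>k. k \<in> set ks \<Longrightarrow> t k = - real (T k)" "X + sum_list (map T ks) < 2 ^ p"
  shows "foldl (fadd p) (- real X) (map t ks) = - real (X + sum_list (map T ks))"
  using assms
proof (induction ks arbitrary: X)
  case (Cons k ks)
  have "fadd p (- real X) (t k) = rd p (- real (X + T k))"
    using Cons.prems(1)[of k] by (simp add: fadd_def)
  also have "\<dots> = - real (X + T k)"
    using Cons.prems(2) by (intro rd_id uminus_in_fx nat_in_fx) auto
  finally have eq: "fadd p (- real X) (t k) = - real (X + T k)" .
  have "foldl (fadd p) (- real (X + T k)) (map t ks) = - real (X + T k + sum_list (map T ks))"
    using Cons.prems by (intro Cons.IH) auto
  then show ?case by (simp add: eq add.assoc)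
qed simp

lemma count_list_filter: "count_list (filter P xs) k = (if P k then count_list xs k else 0)"
  by (induction xs) auto

lemma length_filter_eq_sum_count:
  fixes xs :: "nat list"
  assumes "set xs \<subseteq> {..<d}"
  shows "length (filter P xs) = (\<Sum>k<d. if P k then count_list xs k else 0)"
proof -
  have "length (filter P xs) = sum (count_list (filter P xs)) {..<d}"
    using assms by (intro sum_count_set[symmetric]) auto
  then show ?thesis by (simp add: count_list_filter)
qed

text \<open>A single truncated summand \<open>Suc t\<close> already exceeds \<open>t\<close>. This
  lets multiplicities be cut off at \<open>tau u + 1\<close>, which fits into the precision however
  long the source lists are.\<close>

lemma sum_min_le_iff:
  fixes c :: "nat \<Rightarrow> nat"
  shows "(\<Sum>k<d. min (c k) (Suc t)) \<le> t \<longleftrightarrow> (\<Sum>k<d. c k) \<le> t"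
proof
  assume le: "(\<Sum>k<d. min (c k) (Suc t)) \<le> t"
  have "min (c k) (Suc t) \<le> t" if "k < d" for k
    using le member_le_sum[of k "{..<d}" "\<lambda>k. min (c k) (Suc t)"] that by simp
  then have "(\<Sum>k<d. min (c k) (Suc t)) = (\<Sum>k<d. c k)"
    by (intro sum.cong) fastforce+
  with le show "(\<Sum>k<d. c k) \<le> t" by simp
next
  assume "(\<Sum>k<d. c k) \<le> t"
  then show "(\<Sum>k<d. min (c k) (Suc t)) \<le> t"
    by (meson le_trans min.cobounded1 sum_mono)
qed

definition node_val :: "nat \<Rightarrow> bool list \<Rightarrow> (nat \<Rightarrow> bool) \<Rightarrow> nat \<Rightarrow> bool" where
  "node_val R x s v = (if v < R then s v else x ! (v - R))"

definition net_step :: "nat \<Rightarrow> (nat \<Rightarrow> nat list) \<Rightarrow> (nat \<Rightarrow> nat) \<Rightarrow> bool list \<Rightarrow> (nat \<Rightarrow> bool) \<Rightarrow> nat \<Rightarrow> bool" where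
  "net_step R ls tau x s u \<longleftrightarrow> length (filter (node_val R x s) (ls u)) \<le> tau u"

definition net :: "nat \<Rightarrow> (nat \<Rightarrow> nat list) \<Rightarrow> (nat \<Rightarrow> nat) \<Rightarrow> bool list \<Rightarrow> nat \<Rightarrow> nat \<Rightarrow> bool" where
  "net R ls tau x t = (net_step R ls tau x ^^ t) (\<lambda>u. False)"

text \<open>\<open>tau_inp\<close> is the price of inexact inputs: knowing that a true input is at
  least 1 settles a comparison with 0, but with no larger threshold. \<open>tau_less\<close> makes
  \<open>tau u + 1\<close>, the largest weight and bias, an integer below
  \<open>2 ^ p\<close>.\<close>

locale threshold_net =
  fixes R n p :: nat and ls :: "nat \<Rightarrow> nat list" and tau :: "nat \<Rightarrow> nat"
  assumes n_pos: "1 \<le> n" and p_pos: "1 \<le> p"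
    and ls_sub: "u < R \<Longrightarrow> set (ls u) \<subseteq> {..<R + n}"
    and tau_inp: "u < R \<Longrightarrow> v \<in> set (ls u) \<Longrightarrow> R \<le> v \<Longrightarrow> tau u = 0"
    and tau_less: "u < R \<Longrightarrow> tau u + 2 \<le> 2 ^ p"
begin

text \<open>Coordinates below \<open>R\<close> hold the state, the next \<open>n\<close> the
  gathered input, and the next \<open>n\<close> the bit of the position itself, stored at the index
  of that position. The remaining \<open>2 * R\<close> are padding: \<open>layer_ok\<close> bounds
  the hidden width, here \<open>3 * R\<close>, by the dimension.\<close>

definition d where "d = 3 * R + 2 * n"

definition wt :: "nat \<Rightarrow> nat \<Rightarrow> nat" where "wt u v = min (count_list (ls u) v) (Suc (tau u))"

definition unit_row :: "nat \<Rightarrow> nat \<Rightarrow> real \<Rightarrow> real list" where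
  "unit_row m u c = map (\<lambda>k. if k = u then c else 0) [0..<m]"

definition wt_row :: "nat \<Rightarrow> real list" where
  "wt_row u = map (\<lambda>k. - real (wt u k)) [0..<d]"

text \<open>Neuron u reads h1 - h2 - h3, where h1 - h2 is its new value and h3 cancels, through the
  residual connection, its old value.\<close>

definition ffW1 where
  "ffW1 = map wt_row [0..<R] @ map wt_row [0..<R] @ map (\<lambda>u. unit_row d u 1) [0..<R]"
definition ffb where
  "ffb = map (\<lambda>u. real (Suc (tau u))) [0..<R] @ map (\<lambda>u. real (tau u)) [0..<R] @ map (\<lambda>u. 0) [0..<R]"
definition ffW2 where
  "ffW2 = map (\<lambda>r. if r < R then unit_row R r 1 @ unit_row R r (-1) @ unit_row R r (-1)
                   else unit_row (3 * R) 0 0) [0..<d]"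

lemma wt_sum_le_iff:
  assumes "u < R"
  shows "(\<Sum>k<d. if node_val R x s k then wt u k else 0) \<le> tau u \<longleftrightarrow> net_step R ls tau x s u"
proof -
  have "(\<Sum>k<d. if node_val R x s k then wt u k else 0) =
      (\<Sum>k<d. min (if node_val R x s k then count_list (ls u) k else 0) (Suc (tau u)))"
    by (intro sum.cong) (auto simp: wt_def)
  moreover have "set (ls u) \<subseteq> {..<d}"
    using ls_sub[OF assms] by (auto simp: d_def)
  ultimately show ?thesis
    unfolding net_step_def by (simp only: sum_min_le_iff length_filter_eq_sum_count)
qed

lemma wt_less: "u < R \<Longrightarrow> wt u k < 2 ^ p"
  using tau_less[of u] by (simp add: wt_def min_def)

text \<open>If the test succeeds, all terms are exact integers and the sum is exact. If it fails,
  input terms may be too large and the sum may be clamped, but the one-sided bound survives, and it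
  is enough to make both ReLUs vanish.\<close>

lemma wt_row_dot:
  assumes u: "u < R" and len: "length y = d"
    and node: "\<And>v. v < R \<Longrightarrow> y ! v = of_bool (s v)"
    and inp: "\<And>j. j < n \<Longrightarrow> if x ! j then 1 \<le> y ! (R + j) else y ! (R + j) = 0"
  shows "if net_step R ls tau x s u
    then \<exists>c \<le> tau u. fdot p (wt_row u) y = - real c
    else fdot p (wt_row u) y \<le> - real (Suc (tau u))"
proof -
  define T where "T k = (if node_val R x s k then wt u k else 0)" for k
  define t where "t k = fmul p (- real (wt u k)) (y ! k)" for k
  have fd: "fdot p (wt_row u) y = foldl (fadd p) (- real 0) (map t [0..<d])"
    unfolding wt_row_def fdot_map[OF len] fsum_def t_def by simp
  have sumT: "sum_list (map T [0..<d]) = sum T {..<d}"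
    by (metis atLeast_upt set_upt sum_code sum.set_conv_list sum_set_upt_conv_sum_list_nat)
  have fxw: "rd p (- real (wt u k)) = - real (wt u k)" for k
    using wt_less[OF u] by (intro rd_id uminus_in_fx nat_in_fx) simp
  have eq_node: "t k = - real (T k)" if "k < R" for k
    using that by (simp add: t_def T_def node_val_def node fmul_def fxw)
  have wt0: "wt u k = 0" if "R + n \<le> k" for k
  proof -
    have "k \<notin> set (ls u)" using ls_sub[OF u] that by auto
    then show ?thesis by (simp add: wt_def)
  qed
  have eq_false: "t k = - real (T k)" if "\<not> node_val R x s k" for k
  proof -
    consider "k < R" | "R + n \<le> k" | j where "k = R + j" "j < n"
      by (metis add_less_cancel_left le_Suc_ex not_le)
    then show ?thesis
    proof cases
      case 3
      with inp[of j] that have "y ! k = 0" by (simp add: node_val_def)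
      with that show ?thesis by (simp add: t_def T_def)
    next
      case 2
      then show ?thesis by (simp add: t_def T_def wt0)
    qed (rule eq_node)
  qed
  show ?thesis
  proof (cases "net_step R ls tau x s u")
    case True
    then have le: "sum T {..<d} \<le> tau u"
      using wt_sum_le_iff[OF u, of x s] by (simp add: T_def)
    \<comment> \<open>A true input source of positive weight would force \<open>tau u = 0\<close>
      and push the count above it, so the inexact terms all have weight 0 here.\<close>
    have "t k = - real (T k)" if k: "k < d" for k
    proof (cases "k < R \<or> \<not> node_val R x s k")
      case False
      have "T k \<le> tau u"
        using le member_le_sum[of k "{..<d}" T] k by simp
      moreover have "tau u = 0" if "count_list (ls u) k \<noteq> 0"
        using that False tau_inp[OF u, of k] by (auto simp: count_list_0_iff)
      ultimately have "wt u k = 0"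
        using False by (cases "count_list (ls u) k = 0") (auto simp: T_def wt_def min_def split: if_splits)
      then show ?thesis by (simp add: t_def T_def)
    qed (auto simp: eq_node eq_false)
    then have "fdot p (wt_row u) y = - real (0 + sum_list (map T [0..<d]))"
      unfolding fd using le tau_less[OF u] by (intro foldl_fadd_exact) (auto simp: sumT)
    with le True show ?thesis by (auto simp: sumT)
  next
    case False
    then have ge: "Suc (tau u) \<le> sum T {..<d}"
      using wt_sum_le_iff[OF u, of x s] by (simp add: T_def not_le)
    have "t k \<le> - real (T k)" for k
    proof (cases "k < R \<or> R + n \<le> k \<or> \<not> node_val R x s k")
      case False
      then obtain j where j: "k = R + j" "j < n"
        by (metis add_less_cancel_left le_Suc_ex not_le)
      have "t k \<le> rd p (- real (wt u k))"
        unfolding t_def fmul_def using inp[of j] False j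
        by (intro rd_mono) (auto simp: node_val_def mult_le_cancel_left1)
      with False show ?thesis by (simp add: fxw T_def)
    next
      case True
      then show ?thesis
      proof (elim disjE)
        assume "R + n \<le> k"
        then show ?thesis by (simp add: t_def T_def wt0)
      qed (simp_all add: eq_node eq_false)
    qed
    then have "fdot p (wt_row u) y \<le>
        max (- real (Suc (tau u))) (- real (0 + sum_list (map T [0..<d])))"
      unfolding fd using tau_less[OF u] by (intro foldl_fadd_le) auto
    moreover have "- real (0 + sum_list (map T [0..<d])) \<le> - real (Suc (tau u))"
      using ge by (simp add: sumT del: of_nat_sum of_nat_Suc)
    ultimately show ?thesis using False by (simp only: if_False max_absorb1)
  qed
qed


section \<open>Evaluation of the feedforward layer\<close>

lemma length_unit_row [simp]: "length (unit_row m u c) = m"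
  by (simp add: unit_row_def)

lemma unit_row_dot: "u < m \<Longrightarrow> length y = m \<Longrightarrow> fdot p (unit_row m u c) y = fmul p c (y ! u)"
  unfolding unit_row_def by (subst fdot_map, assumption, subst fsum_single[of u]) auto

lemma zero_row_dot: "length y = m \<Longrightarrow> fdot p (unit_row m u 0) y = 0"
  unfolding unit_row_def by (subst fdot_map, assumption, subst fsum_zeros) auto

definition ff :: "real list \<Rightarrow> real list" where
  "ff y = fvadd p y (fmv p ffW2 (map (max 0) (fvadd p (fmv p ffW1 y) ffb)))"

lemma length_ff: "length y = d \<Longrightarrow> length (ff y) = d"
  by (simp add: ff_def ffW2_def)

lemma ff_hidden:
  "map (max 0) (fvadd p (fmv p ffW1 y) ffb) =
    map (\<lambda>u. max 0 (fadd p (fdot p (wt_row u) y) (real (Suc (tau u))))) [0..<R] @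
    map (\<lambda>u. max 0 (fadd p (fdot p (wt_row u) y) (real (tau u)))) [0..<R] @
    map (\<lambda>u. max 0 (fadd p (fdot p (unit_row d u 1) y) 0)) [0..<R]"
  unfolding fmv_def fvadd_def ffW1_def ffb_def
  by (simp add: map2_map_map del: of_nat_Suc)

lemma three_unit_rows_dot:
  assumes "r < R"
  shows "fdot p (unit_row R r a @ unit_row R r b @ unit_row R r c)
      (map h1 [0..<R] @ map h2 [0..<R] @ map h3 [0..<R]) =
    fadd p (fadd p (fmul p a (h1 r)) (fmul p b (h2 r))) (fmul p c (h3 r))"
proof -
  have *: "foldl (fadd p) e (map2 (fmul p) (unit_row R r a) (map h [0..<R])) = fadd p e (fmul p a (h r))"
    if "e \<in> fx p" for e a and h :: "nat \<Rightarrow> real"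
    unfolding unit_row_def map2_map_map using assms that
    by (subst foldl_fadd_single[of _ _ r]) auto
  show ?thesis
    by (simp add: fdot_def fsum_def *)
qed

lemma ff_other:
  assumes "length y = d" "R \<le> r" "r < d" "y ! r \<in> fx p"
  shows "ff y ! r = y ! r"
proof -
  have "fdot p (ffW2 ! r) (map (max 0) (fvadd p (fmv p ffW1 y) ffb)) = 0"
    using assms unfolding ff_hidden by (simp add: ffW2_def zero_row_dot)
  with assms show ?thesis
    by (simp add: ff_def nth_fvadd nth_fmv ffW2_def)
qed

lemma one_less_pow: "1 < (2::nat) ^ p"
  using p_pos by (intro one_less_power) auto

text \<open>The row of \<open>ffW2\<close> is summed as \<open>h1 - h2\<close>, then minus the old
  value, and the residual connection adds the old value back. From \<open>h1 - h2\<close> on all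
  results lie in \<open>{-1, 0, 1}\<close>, so they are exact even for \<open>p = 1\<close>.\<close>

lemma ff_node:
  assumes r: "r < R" and len: "length y = d"
    and node: "\<And>v. v < R \<Longrightarrow> y ! v = of_bool (s v)"
    and inp: "\<And>j. j < n \<Longrightarrow> if x ! j then 1 \<le> y ! (R + j) else y ! (R + j) = 0"
  shows "ff y ! r = of_bool (net_step R ls tau x s r)"
proof -
  define S where "S = fdot p (wt_row r) y"
  define h1 where "h1 = max 0 (fadd p S (real (Suc (tau r))))"
  define h2 where "h2 = max 0 (fadd p S (real (tau r)))"
  define h3 where "h3 = max 0 (fadd p (fdot p (unit_row d r 1) y) 0)"
  have "1 \<in> fx p"
    using nat_in_fx[of 1 p] one_less_pow by simp
  then have rd1: "rd p 1 = 1" "rd p (-1) = -1"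
    using uminus_in_fx[of 1 p] by (simp_all add: rd_id)
  have "r < d" using r by (simp add: d_def)
  have h3: "h3 = of_bool (s r)"
    using \<open>r < d\<close> r by (simp add: h3_def unit_row_dot len node fmul_def fadd_def rd1)
  have ff: "ff y ! r = fadd p (of_bool (s r)) (fadd p (fadd p (fmul p 1 h1) (fmul p (-1) h2)) (fmul p (-1) h3))"
    using \<open>r < d\<close> len r unfolding ff_def ff_hidden h1_def h2_def h3_def S_def
    by (simp add: nth_fvadd nth_fmv ffW2_def three_unit_rows_dot node del: of_nat_Suc)
  have fin: "ff y ! r = of_bool b" if "fadd p (fmul p 1 h1) (fmul p (-1) h2) = of_bool b" for b
    unfolding ff that h3 by (cases b; cases "s r") (auto simp: fmul_def fadd_def rd1)
  show ?thesis
  proof (cases "net_step R ls tau x s r")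
    case True
    then obtain c where c: "c \<le> tau r" "S = - real c"
      using wt_row_dot[OF r len node inp] unfolding S_def by auto
    have rd_nat: "rd p (real k) = real k" "rd p (- real k) = - real k" if "k \<le> Suc (tau r)" for k
      using tau_less[OF r] that by (auto intro!: rd_id uminus_in_fx nat_in_fx)
    have "S + real (Suc (tau r)) = real (Suc (tau r - c))" "S + real (tau r) = real (tau r - c)"
      using c by (simp_all add: of_nat_diff)
    then have "h1 = real (Suc (tau r - c))" "h2 = real (tau r - c)"
      using c rd_nat(1)[of "Suc (tau r - c)"] rd_nat(1)[of "tau r - c"]
      by (simp_all only: h1_def h2_def fadd_def)
    moreover have "fmul p 1 (real (Suc (tau r - c))) = real (Suc (tau r - c))"
        "fmul p (-1) (real (tau r - c)) = - real (tau r - c)"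
      using rd_nat[of "Suc (tau r - c)"] rd_nat[of "tau r - c"] c by (auto simp: fmul_def)
    ultimately have "fadd p (fmul p 1 h1) (fmul p (-1) h2) = of_bool True"
      by (simp add: fadd_def rd1)
    from fin[OF this] True show ?thesis by simp
  next
    case False
    then have "S \<le> - real (Suc (tau r))"
      using wt_row_dot[OF r len node inp] unfolding S_def by auto
    then have "rd p (S + real (Suc (tau r))) \<le> rd p 0" "rd p (S + real (tau r)) \<le> rd p 0"
      by (intro rd_mono; simp)+
    then have "h1 = 0" "h2 = 0"
      by (simp_all add: h1_def h2_def fadd_def)
    then have "fadd p (fmul p 1 h1) (fmul p (-1) h2) = of_bool False"
      by simp
    from fin[OF this] False show ?thesis by simp
  qed
qed

section \<open>Uniform attention and the gathered input\<close>

definition big :: real where "big = of_int (maxk p) / 2 ^ p"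

definition attn_V where
  "attn_V = map (\<lambda>r. if R \<le> r \<and> r < R + n then unit_row d (r + n) big else unit_row d 0 0) [0..<d]"

text \<open>With empty query and key matrices every score is an empty dot product, hence 0, and its
  exponential is 1: the attention is uniform. The value matrix moves coordinate
  \<open>R + n + j\<close> to \<open>R + j\<close>.\<close>

definition attn :: head where "attn = \<lparr>hQ = [], hK = [], hV = attn_V\<rparr>"

text \<open>The normalizer is a sum of ones that stays at least 1 and is clamped to at most
  \<open>2 ^ p\<close>. So its reciprocal is at least the smallest positive number
  \<open>1 / 2 ^ p\<close>, however large \<open>n\<close> is, and the factor \<open>big\<close>
  makes up for that.\<close>

lemma attn_weight:
  assumes "length zs = n"
  defines "w \<equiv> rd p (1 / fsum p (replicate n 1))"
  shows "head_out p attn zs i =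
      fvsum p (length (zs ! i)) (map (\<lambda>z. map (fmul p w) (fmv p attn_V z)) zs)"
    and "1 \<le> fmul p w big"
proof -
  have p2: "2 \<le> (2::real) ^ p"
    using p_pos by (metis one_le_numeral power_increasing power_one_right)
  have fx1: "1 \<in> fx p"
    using nat_in_fx[of 1 p] one_less_pow by simp
  have "map (\<lambda>e. rd p (e / fsum p (replicate n 1))) (replicate n 1) = replicate n w"
    by (simp add: w_def)
  moreover have "map (\<lambda>zj. rd p (exp (fdot p (fmv p (hQ attn) (zs ! i)) (fmv p (hK attn) zj)))) zs = replicate n 1"
    using assms fx1 by (simp add: attn_def fmv_def fdot_def fsum_def rd_id map_replicate_const)
  moreover have "map2 (\<lambda>w zj. map (fmul p w) (fmv p attn_V zj)) (replicate n w) zs = map (\<lambda>z. map (fmul p w) (fmv p attn_V z)) zs"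
    using assms by (intro nth_equalityI) auto
  ultimately show "head_out p attn zs i =
      fvsum p (length (zs ! i)) (map (\<lambda>z. map (fmul p w) (fmv p attn_V z)) zs)"
    unfolding head_out_def Let_def by (simp only:) (simp add: attn_def)
  have ge: "1 \<le> foldl (fadd p) a (replicate m 1)" if "1 \<le> a" for a m
    using that
  proof (induction m arbitrary: a)
    case (Suc m)
    have "rd p 1 \<le> rd p (a + 1)" using Suc.prems by (intro rd_mono) simp
    then have "1 \<le> fadd p a 1" using fx1 by (simp add: fadd_def rd_id)
    from Suc.IH[OF this] show ?case by simp
  qed simp
  define Z where "Z = fsum p (replicate n 1)"
  have "1 \<le> Z"
    using n_pos fx1 ge[of 1 "n - 1"] by (cases n) (auto simp: Z_def fsum_def)
  moreover have "Z \<in> fx p" by (simp add: Z_def)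
  then have "Z \<le> 2 ^ p" by (rule fx_le)
  ultimately have "1 / 2 ^ p \<le> 1 / Z"
    by (simp add: divide_simps)
  moreover have "rd p (1 / 2 ^ p) = 1 / 2 ^ p"
    using rd_of_int[of p 1] maxk_pos[OF p_pos] by simp
  ultimately have w: "1 / 2 ^ p \<le> w"
    using rd_mono[of "1 / 2 ^ p" "1 / Z" p] by (simp add: w_def Z_def)
  have big: "big = 2 ^ p - 1 / 2 ^ p"
    unfolding big_def maxk_def mult_2 power_add by (simp add: field_simps)
  have "big \<ge> 0"
    unfolding big_def by simp
  \<comment> \<open>The product is \<open>1 - 1 / 2 ^ (2 * p)\<close>, at most half a unit below 1,
    and \<open>rd\<close> rounds ties up. For \<open>p = 1\<close>, the precision used for AND and
    OR, it is exactly a tie.\<close>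
  have "1 - 1 / (2 * 2 ^ p) \<le> 1 / 2 ^ p * big"
    using p2 unfolding big by (simp add: field_simps)
  also have "\<dots> \<le> w * big"
    using w \<open>big \<ge> 0\<close> by (intro mult_right_mono)
  finally have "rd p (1 - 1 / (2 * 2 ^ p)) \<le> fmul p w big"
    unfolding fmul_def by (rule rd_mono)
  moreover have "\<lfloor>(1 - 1 / (2 * 2 ^ p) :: real) * 2 ^ p + 1 / 2\<rfloor> = 2 ^ p"
    by (simp add: left_diff_distrib floor_eq_iff)
  then have "rd p (1 - 1 / (2 * 2 ^ p)) = rd p (of_int (2 ^ p) / 2 ^ p)"
    unfolding rd_of_int unfolding rd_eq by simp
  ultimately show "1 \<le> fmul p w big"
    using fx1 by (simp add: rd_id)
qed

lemma length_head_out: "length zs = n \<Longrightarrow> length (zs ! i) = d \<Longrightarrow> length (head_out p attn zs i) = d"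
  by (simp add: attn_weight) (auto intro!: length_fvsum simp: attn_V_def)

lemma nth_head_out:
  assumes "length zs = n" "\<And>j. j < n \<Longrightarrow> length (zs ! j) = d" "i < n" "r < d"
  shows "head_out p attn zs i ! r = (if R \<le> r \<and> r < R + n then
     fsum p (map (\<lambda>j. fmul p (rd p (1 / fsum p (replicate n 1))) (fmul p big (zs ! j ! (r + n)))) [0..<n]) else 0)"
proof -
  let ?w = "rd p (1 / fsum p (replicate n 1))"
  have "head_out p attn zs i ! r = fsum p (map (\<lambda>j. fmul p ?w (fdot p (attn_V ! r) (zs ! j))) [0..<n])"
    unfolding attn_weight(1)[OF assms(1)] assms(2)[OF assms(3)] using assms
    by (subst nth_fvsum) (auto simp: attn_V_def nth_fmv intro!: arg_cong[where f = "fsum p"] nth_equalityI)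
  moreover have "fdot p (attn_V ! r) (zs ! j) = (if R \<le> r \<and> r < R + n then fmul p big (zs ! j ! (r + n)) else 0)"
    if "j < n" for j
    using assms that by (auto simp: attn_V_def zero_row_dot unit_row_dot d_def)
  ultimately show ?thesis
    by (auto simp: fsum_zeros intro!: arg_cong[where f = "fsum p"])
qed


section \<open>The looped transformer and its invariant\<close>

definition net_layer :: layer where
  "net_layer = \<lparr>heads = [attn], W1 = ffW1, b1 = ffb, W2 = ffW2\<rparr>"

definition net_emb :: "nat \<Rightarrow> bool \<Rightarrow> real list" where
  "net_emb i b = unit_row d (R + n + i) (of_bool b)"

text \<open>A gathered coordinate starts at 0 and grows through the residual connection, so between
  iterations a true bit is only known to be nonnegative there. The attention step lifts it to at
  least 1 before the feedforward layer reads it.\<close>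

definition simulates :: "bool list \<Rightarrow> (nat \<Rightarrow> bool) \<Rightarrow> real list list \<Rightarrow> bool" where
  "simulates x s zs \<longleftrightarrow> length zs = n \<and> (\<forall>i<n. length (zs ! i) = d \<and> set (zs ! i) \<subseteq> fx p
     \<and> (\<forall>v<R. zs ! i ! v = of_bool (s v))
     \<and> (\<forall>j<n. 0 \<le> zs ! i ! (R + j) \<and> (\<not> x ! j \<longrightarrow> zs ! i ! (R + j) = 0))
     \<and> (\<forall>j<n. zs ! i ! (R + n + j) = of_bool (j = i \<and> x ! j)))"

lemma simulates_step:
  assumes sim: "simulates x s zs"
  shows "simulates x (net_step R ls tau x s) (layer_apply p net_layer zs)"
proof -
  have len: "length zs = n" and lend: "\<And>i. i < n \<Longrightarrow> length (zs ! i) = d"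
    and fx: "\<And>i. i < n \<Longrightarrow> set (zs ! i) \<subseteq> fx p"
    using sim by (auto simp: simulates_def)
  have zfx: "zs ! i ! r \<in> fx p" if "i < n" "r < d" for i r
    using that fx[of i] lend[of i] nth_mem[of r "zs ! i"] by auto
  define y where "y i = fvadd p (zs ! i) (fvsum p (length (zs ! i)) [head_out p attn zs i])" for i
  have lay: "layer_apply p net_layer zs = map (\<lambda>i. ff (y i)) [0..<n]"
    by (simp add: layer_apply_def net_layer_def ff_def y_def len comp_def)
  let ?w = "rd p (1 / fsum p (replicate n 1))"
  have leny: "length (y i) = d" if "i < n" for i
    using that len lend by (simp add: y_def fvsum_def length_head_out)
  have ho_fx: "head_out p attn zs i ! r \<in> fx p" if "i < n" "r < d" for i r
    using that by (subst nth_head_out) (auto simp: len lend)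
  have y: "y i ! r = fadd p (zs ! i ! r) (head_out p attn zs i ! r)" if "i < n" "r < d" for i r
    using that len lend ho_fx[OF that]
    by (simp add: y_def fvsum_def nth_fvadd length_head_out)
  have y_other: "y i ! r = zs ! i ! r" if "i < n" "r < d" "\<not> (R \<le> r \<and> r < R + n)" for i r
    using that by (auto simp: y nth_head_out len lend zfx)
  have y_inp: "if x ! j then 1 \<le> y i ! (R + j) else y i ! (R + j) = 0" if "i < n" "j < n" for i j
  proof -
    have "R + j < d" using that by (simp add: d_def)
    let ?f = "\<lambda>l. fmul p ?w (fmul p big (zs ! l ! (R + j + n)))"
    have val: "zs ! l ! (R + j + n) = of_bool (j = l \<and> x ! j)" if "l < n" for l
    proof -
      have "zs ! l ! (R + n + j) = of_bool (j = l \<and> x ! j)"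
        using sim that \<open>j < n\<close> by (simp add: simulates_def)
      then show ?thesis by (simp only: add.assoc add.commute[of n])
    qed
    have "big \<in> fx p"
      unfolding big_def fx_iff by (intro exI[of _ "maxk p"]) simp
    then have big1: "fmul p big 1 = big" by (simp add: fmul_def rd_id)
    have ho: "head_out p attn zs i ! (R + j) = fsum p (map ?f [0..<n])"
      using that \<open>R + j < d\<close> by (simp add: nth_head_out len lend)
    \<comment> \<open>Coordinate \<open>R + n + j\<close> vanishes at every position other than
      \<open>j\<close>, so the sum over positions has one term.\<close>
    also have "\<dots> = ?f j"
      using that by (intro fsum_single) (auto simp: val)
    finally have ho: "head_out p attn zs i ! (R + j) = fmul p ?w (fmul p big (of_bool (x ! j)))"
      using val[OF that(2)] by simp
    have z: "0 \<le> zs ! i ! (R + j)" "\<not> x ! j \<longrightarrow> zs ! i ! (R + j) = 0"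
      using sim that by (auto simp: simulates_def)
    show ?thesis
    proof (cases "x ! j")
      case True
      have "1 \<le> fmul p ?w big" using attn_weight(2)[OF len] .
      then have "rd p (fmul p ?w big) \<le> y i ! (R + j)"
        unfolding y[OF that(1) \<open>R + j < d\<close>] ho fadd_def using z True
        by (intro rd_mono) (simp add: big1)
      with \<open>1 \<le> fmul p ?w big\<close> True show ?thesis by (simp add: rd_id)
    qed (use y[OF that(1) \<open>R + j < d\<close>] z in \<open>simp add: ho\<close>)
  qed
  have yfx: "y i ! r \<in> fx p" if "i < n" "r < d" for i r
    using that by (simp add: y)
  have y_node: "y i ! v = of_bool (s v)" if "i < n" "v < R" for i v
    using that y_other[of i v] sim by (simp add: d_def simulates_def)
  have ff_fx: "set (ff (y i)) \<subseteq> fx p" if "i < n" for i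
    using leny[OF that] by (auto simp: ff_def fvadd_def set_zip)
  show ?thesis
    unfolding simulates_def lay
  proof (intro conjI allI impI)
    fix i j assume ij: "i < n" "j < n"
    have eq: "map (\<lambda>i. ff (y i)) [0..<n] ! i ! (R + j) = y i ! (R + j)"
      "map (\<lambda>i. ff (y i)) [0..<n] ! i ! (R + n + j) = y i ! (R + n + j)"
      using ij by (auto intro!: ff_other leny yfx simp: d_def)
    show "0 \<le> map (\<lambda>i. ff (y i)) [0..<n] ! i ! (R + j)"
      unfolding eq using y_inp[OF ij] by (auto split: if_splits)
    show "map (\<lambda>i. ff (y i)) [0..<n] ! i ! (R + j) = 0" if "\<not> x ! j"
      unfolding eq using y_inp[OF ij] that by auto
    show "map (\<lambda>i. ff (y i)) [0..<n] ! i ! (R + n + j) = of_bool (j = i \<and> x ! j)"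
      unfolding eq using ij sim by (subst y_other) (auto simp: d_def simulates_def)
  next
    fix i v assume iv: "i < n" "v < R"
    show "map (\<lambda>i. ff (y i)) [0..<n] ! i ! v = of_bool (net_step R ls tau x s v)"
      using iv ff_node[OF iv(2) leny[OF iv(1)] y_node[OF iv(1)] y_inp[OF iv(1)]] by simp
  qed (auto simp: leny length_ff ff_fx[THEN subsetD])
qed

definition net_tf :: "nat \<Rightarrow> nat \<Rightarrow> looped_tf" where
  "net_tf out T = \<lparr>emb = net_emb, blk = [net_layer], wo0 = unit_row d 0 0, wo1 = unit_row d out 1,
     dim = d, prec = p, iters = T\<rparr>"

lemma unit_row_ok: "c \<in> fx p \<Longrightarrow> vec_ok p m (unit_row m u c)"
  by (auto simp: vec_ok_def unit_row_def)

lemma net_tf_ok: "lt_ok n (net_tf out T)"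
proof -
  have fx1: "1 \<in> fx p" "-1 \<in> fx p"
    using nat_in_fx[of 1 p] uminus_in_fx[of 1 p] one_less_pow by auto
  have "big \<in> fx p"
    unfolding big_def fx_iff by (intro exI[of _ "maxk p"]) simp
  then have V: "mat_ok p d d attn_V"
    by (auto simp: mat_ok_def attn_V_def unit_row_ok)
  have W1: "mat_ok p (3 * R) d ffW1"
    using wt_less fx1
    by (auto simp: mat_ok_def ffW1_def unit_row_ok)
       (auto simp: vec_ok_def wt_row_def intro!: uminus_in_fx nat_in_fx)
  have b: "vec_ok p (3 * R) ffb"
    using tau_less by (auto simp: vec_ok_def ffb_def simp del: of_nat_Suc intro!: nat_in_fx)
      (meson Suc_leD add_2_eq_Suc' le_less_trans lessI less_le_trans order_less_le_trans)+
  have W2: "mat_ok p d (3 * R) ffW2"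
    using fx1 by (auto simp: mat_ok_def ffW2_def vec_ok_def unit_row_def)
  have "3 * R \<le> d" by (simp add: d_def)
  then have "layer_ok p d net_layer"
    using V W1 b W2 by (auto simp: layer_ok_def net_layer_def attn_def head_ok_def mat_ok_def)
  then show ?thesis
    using fx1 by (auto simp: lt_ok_def net_tf_def net_emb_def unit_row_ok)
qed

lemma net_tf_out:
  assumes "length x = n" "out < R"
  shows "lt_out (net_tf out T) x = net R ls tau x T out"
proof -
  define z0 where "z0 = map (\<lambda>i. net_emb i (x ! i)) [0..<length x]"
  have fx1: "1 \<in> fx p"
    using nat_in_fx[of 1 p] one_less_pow by auto
  have "set (net_emb i b) \<subseteq> fx p" for i b
    using unit_row_ok[of "of_bool b" d "R + n + i"] fx1 by (cases b) (auto simp: net_emb_def vec_ok_def)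
  then have "simulates x (\<lambda>u. False) z0"
    using assms(1) fx1 by (auto simp: simulates_def z0_def net_emb_def unit_row_def d_def)
  then have sim: "simulates x (net R ls tau x T) ((block_apply p [net_layer] ^^ T) z0)"
    by (induction T) (auto simp: net_def block_apply_def simulates_step)
  define zl where "zl = last ((block_apply p [net_layer] ^^ T) z0)"
  have "zl = (block_apply p [net_layer] ^^ T) z0 ! (n - 1)"
    using sim n_pos unfolding zl_def simulates_def by (subst last_conv_nth) auto
  then have "length zl = d" "zl ! out = of_bool (net R ls tau x T out)"
    using sim n_pos assms(2) by (auto simp: simulates_def)
  moreover have "out < d" using assms(2) by (simp add: d_def)
  moreover have "lt_out (net_tf out T) x \<longleftrightarrow> fdot p (unit_row d 0 0) zl < fdot p (unit_row d out 1) zl"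
    by (simp add: lt_out_def net_tf_def z0_def zl_def Let_def)
  ultimately show ?thesis
    using fx1 by (simp add: zero_row_dot unit_row_dot fmul_def rd_id)
qed

end

section \<open>Circuits as threshold networks\<close>

lemma length_foldl_snoc: "length (foldl (\<lambda>vs g. vs @ [F vs g]) vs C) = length vs + length C"
  by (induction C arbitrary: vs) auto

lemma take_foldl_snoc: "take (length vs) (foldl (\<lambda>vs g. vs @ [F vs g]) vs C) = vs"
proof (induction C rule: rev_induct)
  case (snoc g C)
  then show ?case by (simp add: length_foldl_snoc)
qed simp

text \<open>Appending never alters earlier entries, so entry \<open>i\<close> can be computed from
  the final list cut at \<open>i\<close>. As wires of a well-formed circuit point backwards, this
  yields equations for \<open>circ_vals\<close> and \<open>gate_depths\<close> over the whole
  list.\<close>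

lemma nth_foldl_snoc:
  fixes F
  defines "scan \<equiv> foldl (\<lambda>vs g. vs @ [F vs g]) []"
  assumes "i < length C"
  shows "scan C ! i = F (take i (scan C)) (C ! i)"
proof -
  let ?f = "\<lambda>vs g. vs @ [F vs g]"
  have C: "C = take i C @ C ! i # drop (Suc i) C"
    using assms(2) by (simp add: id_take_nth_drop)
  have len: "length (scan (take i C)) = i"
    using assms(2) by (simp add: scan_def length_foldl_snoc)
  have sc: "scan C = foldl ?f (scan (take i C) @ [F (scan (take i C)) (C ! i)]) (drop (Suc i) C)"
    unfolding scan_def by (subst C, subst foldl_append) simp
  have tk: "take (Suc i) (scan C) = scan (take i C) @ [F (scan (take i C)) (C ! i)]"
    using take_foldl_snoc[of "scan (take i C) @ [F (scan (take i C)) (C ! i)]" F "drop (Suc i) C"] len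
    unfolding sc by simp
  then have "take i (take (Suc i) (scan C)) = scan (take i C)"
    using len by simp
  then have "take i (scan C) = scan (take i C)" by (simp add: min_def)
  moreover have "scan C ! i = take (Suc i) (scan C) ! i" by simp
  then have "scan C ! i = F (scan (take i C)) (C ! i)"
    unfolding tk using len by (simp add: nth_append)
  ultimately show ?thesis by simp
qed

lemma length_circ_vals [simp]: "length (circ_vals x C) = length C"
  by (simp add: circ_vals_def length_foldl_snoc)

lemma length_gate_depths [simp]: "length (gate_depths C) = length C"
  by (simp add: gate_depths_def length_foldl_snoc)

lemma nth_foldl_snoc_append:
  assumes "i < length C"
  shows "foldl (\<lambda>vs g. vs @ [F vs g]) [] (C @ E) ! i = foldl (\<lambda>vs g. vs @ [F vs g]) [] C ! i"
proof -
  let ?s = "foldl (\<lambda>vs g. vs @ [F vs g]) []"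
  have "take (length (?s C)) (?s (C @ E)) ! i = ?s C ! i"
    unfolding foldl_append take_foldl_snoc ..
  with assms show ?thesis by (simp add: length_foldl_snoc)
qed

lemma nth_append_circ_vals: "i < length C \<Longrightarrow> circ_vals x (C @ E) ! i = circ_vals x C ! i"
  unfolding circ_vals_def by (rule nth_foldl_snoc_append)

lemma nth_append_gate_depths: "i < length C \<Longrightarrow> gate_depths (C @ E) ! i = gate_depths C ! i"
  unfolding gate_depths_def by (rule nth_foldl_snoc_append)

definition wire_ok :: "nat \<Rightarrow> nat \<Rightarrow> wire \<Rightarrow> bool" where
  "wire_ok n i w = (case w of Inp j \<Rightarrow> j < n | Gt m \<Rightarrow> m < i)"

definition gates_ok :: "nat \<Rightarrow> circuit \<Rightarrow> bool" where
  "gates_ok n C \<longleftrightarrow> (\<forall>i<length C. (\<forall>w\<in>set (snd (C ! i)). wire_ok n i w)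
     \<and> (fst (C ! i) = GNot \<longrightarrow> length (snd (C ! i)) = 1))"

lemma circ_wf_iff: "circ_wf n C \<longleftrightarrow> C \<noteq> [] \<and> gates_ok n C"
  by (simp add: circ_wf_def gates_ok_def wire_ok_def)

lemma nth_circ_vals:
  assumes "gates_ok n C" "i < length C"
  shows "circ_vals x C ! i = gate_val (fst (C ! i)) (map (wire_val x (circ_vals x C)) (snd (C ! i)))"
proof -
  have "circ_vals x C ! i = gate_val (fst (C ! i)) (map (wire_val x (take i (circ_vals x C))) (snd (C ! i)))"
    unfolding circ_vals_def using assms(2) by (subst nth_foldl_snoc) auto
  moreover have "wire_val x (take i (circ_vals x C)) w = wire_val x (circ_vals x C) w"
    if "w \<in> set (snd (C ! i))" for w
    using assms that by (auto simp: gates_ok_def wire_ok_def wire_val_def split: wire.splits)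
  ultimately show ?thesis by (simp cong: map_cong)
qed

lemma nth_gate_depths:
  assumes "gates_ok n C" "i < length C"
  shows "gate_depths C ! i = 1 + Max (insert 0 (wire_depth (gate_depths C) ` set (snd (C ! i))))"
proof -
  have "gate_depths C ! i = 1 + Max (insert 0 (set (map (wire_depth (take i (gate_depths C))) (snd (C ! i)))))"
    unfolding gate_depths_def using assms(2) by (subst nth_foldl_snoc) auto
  moreover have "wire_depth (take i (gate_depths C)) w = wire_depth (gate_depths C) w"
    if "w \<in> set (snd (C ! i))" for w
    using assms that by (auto simp: gates_ok_def wire_ok_def wire_depth_def split: wire.splits)
  ultimately show ?thesis by (simp cong: image_cong)
qed

lemma gate_depths_le_circ_depth: "i < length C \<Longrightarrow> gate_depths C ! i \<le> circ_depth C"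
  unfolding circ_depth_def by (intro Max_ge) auto

text \<open>Wire w is represented by two network nodes: its value at index w and its negation at
  index N + w, where N is the number of wires; raw input j has index 2 N + j.\<close>

fun wire_index :: "nat \<Rightarrow> wire \<Rightarrow> nat" where
  "wire_index n (Inp j) = j" | "wire_index n (Gt m) = n + m"

text \<open>The flag tells whether the list of sources defines the value node or the negation node.\<close>

fun gate_node :: "nat \<Rightarrow> nat \<Rightarrow> gate \<times> wire list \<Rightarrow> bool \<times> nat list \<times> nat" where
  "gate_node n N (GAnd, ws) = (True, map (\<lambda>w. N + wire_index n w) ws, 0)"
| "gate_node n N (GNot, ws) = (True, map (wire_index n) ws, 0)"
| "gate_node n N (GOr, ws) = (False, map (wire_index n) ws, 0)"
| "gate_node n N (GThr 0, ws) = (True, [], 0)"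
| "gate_node n N (GThr (Suc t), ws) = (False, map (wire_index n) ws, min t (length ws))"

text \<open>Of each pair one node is computed from the sources, the other is the negation of its
  partner with threshold 0. A raw input feeds only the negation of its wire, again with threshold 0,
  as \<open>tau_inp\<close> demands; the value follows one iteration later.\<close>

definition circ_node :: "nat \<Rightarrow> circuit \<Rightarrow> nat \<Rightarrow> nat list \<times> nat" where
  "circ_node n C u = (let N = n + length C in
     if u < n then ([N + u], 0)
     else if u < N then (case gate_node n N (C ! (u - n)) of (b, l, t) \<Rightarrow> if b then (l, t) else ([N + u], 0))
     else if u < N + n then ([2 * N + (u - N)], 0)
     else (case gate_node n N (C ! (u - N - n)) of (b, l, t) \<Rightarrow> if b then ([u - N], 0) else (l, t)))"

lemma net_Suc: "net R ls tau x (Suc t) u \<longleftrightarrow> length (filter (node_val R x (net R ls tau x t)) (ls u)) \<le> tau u"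
  by (simp add: net_def net_step_def)

text \<open>The claim is for all later times \<open>t\<close>, since sources settle at different
  times and must then stay put. Inputs need two iterations. Once all sources of a gate are right,
  the node that \<open>gate_node\<close> defines is right one iteration later and its partner after
  another.\<close>

lemma net_circuit:
  fixes n C
  defines "N \<equiv> n + length C"
  defines "ls \<equiv> \<lambda>u. fst (circ_node n C u)" and "tau \<equiv> \<lambda>u. snd (circ_node n C u)"
  assumes ok: "gates_ok n C"
  shows "wire_ok n (length C) w \<Longrightarrow> 2 * wire_depth (gate_depths C) w + 2 \<le> t \<Longrightarrow>
     net (2 * N) ls tau x t (wire_index n w) = wire_val x (circ_vals x C) w
   \<and> net (2 * N) ls tau x t (N + wire_index n w) = (\<not> wire_val x (circ_vals x C) w)"
proof (induction "wire_depth (gate_depths C) w" arbitrary: w t rule: less_induct)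
  case less
  let ?net = "net (2 * N) ls tau x"
  show ?case
  proof (cases w)
    case (Inp j)
    then have j: "j < n" using less.prems by (simp add: wire_ok_def)
    have B: "?net (Suc t) (N + j) = (\<not> x ! j)" for t
      unfolding net_Suc using j
      by (simp add: ls_def tau_def circ_node_def Let_def node_val_def flip: N_def)
    have A: "?net (Suc (Suc t)) j = (x ! j)" for t
      unfolding net_Suc[of _ _ _ _ "Suc t"] using j B[of t]
      by (simp add: ls_def tau_def circ_node_def Let_def node_val_def flip: N_def) (simp add: N_def)
    from less.prems have "t = Suc (Suc (t - 2))" by simp
    then obtain t' where "t = Suc (Suc t')" ..
    then show ?thesis using A[of t'] B[of "Suc t'"] Inp by (simp add: wire_val_def)
  next
    case (Gt m)
    then have m: "m < length C" using less.prems by (simp add: wire_ok_def)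
    obtain g ws where gw: "C ! m = (g, ws)" by fastforce
    define v where "v = circ_vals x C ! m"
    have v: "v = gate_val g (map (wire_val x (circ_vals x C)) ws)"
      unfolding v_def using nth_circ_vals[OF ok m, of x] gw by simp
    define dp where "dp = gate_depths C ! m"
    have dw: "wire_depth (gate_depths C) w' < dp" if "w' \<in> set ws" for w'
      unfolding dp_def nth_gate_depths[OF ok m] gw using that
      by (simp add: less_Suc_eq_le)
    have wok: "wire_ok n (length C) w'" if "w' \<in> set ws" for w'
      using ok m that gw by (fastforce simp: gates_ok_def wire_ok_def split: wire.splits)
    have idx: "wire_index n w' < N" if "w' \<in> set ws" for w'
      using wok[OF that] by (cases w') (auto simp: wire_ok_def N_def)
    have src: "?net t (wire_index n w') = wire_val x (circ_vals x C) w'"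
        "?net t (N + wire_index n w') = (\<not> wire_val x (circ_vals x C) w')"
      if "w' \<in> set ws" "2 * dp \<le> t" for t w'
      using less.hyps[of w' t] dw[OF that(1)] wok[OF that(1)] that Gt
      by (auto simp: dp_def wire_depth_def)
    have notlen: "length ws = 1" if "g = GNot"
      using ok m gw that by (fastforce simp: gates_ok_def)
    have srcA: "length (filter (node_val (2 * N) x (?net t)) (map (wire_index n) ws)) =
        length (filter id (map (wire_val x (circ_vals x C)) ws))" if "2 * dp \<le> t" for t
      unfolding filter_map length_map using idx src that
      by (intro arg_cong[where f = length] filter_cong) (auto simp: node_val_def trans_less_add1 mult_2)
    have srcB: "length (filter (node_val (2 * N) x (?net t)) (map (\<lambda>w. N + wire_index n w) ws)) =
        length (filter Not (map (wire_val x (circ_vals x C)) ws))" if "2 * dp \<le> t" for t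
      unfolding filter_map length_map using idx src that
      by (intro arg_cong[where f = length] filter_cong) (auto simp: node_val_def mult_2)
    obtain b l \<theta> where gn: "gate_node n N (g, ws) = (b, l, \<theta>)" by (metis prod_cases3)
    have prim: "(length (filter (node_val (2 * N) x (?net t)) l) \<le> \<theta>) = (if b then v else \<not> v)"
      if "2 * dp \<le> t" for t
    proof (cases g)
      case GNot
      then obtain w' where "ws = [w']" using notlen by (metis One_nat_def length_0_conv length_Suc_conv)
      then show ?thesis using gn srcA[OF that] GNot by (auto simp: v gate_val_def split: if_splits)
    next
      case (GThr t')
      then show ?thesis
      proof (cases t')
        case (Suc t'')
        \<comment> \<open>This makes the cap \<open>min t (length ws)\<close> in
          \<open>gate_node\<close> harmless.\<close>
        have "length (filter id (map (wire_val x (circ_vals x C)) ws)) \<le> length ws"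
          by (metis length_filter_le length_map)
        then show ?thesis using gn srcA[OF that] GThr Suc by (auto simp: v gate_val_def)
      qed (use gn in \<open>auto simp: v gate_val_def\<close>)
    qed (use gn srcA[OF that] srcB[OF that] in
          \<open>auto simp: v gate_val_def list_all_iff list_ex_iff filter_empty_conv\<close>)
    have mN: "n + m < N" using m by (simp add: N_def)
    have nA: "circ_node n C (n + m) = (if b then (l, \<theta>) else ([N + (n + m)], 0))"
      using mN gn gw by (simp add: circ_node_def Let_def flip: N_def)
    have nB: "circ_node n C (N + (n + m)) = (if b then ([n + m], 0) else (l, \<theta>))"
      using mN gn gw by (simp add: circ_node_def Let_def flip: N_def)
    have first: "?net (Suc t) (if b then n + m else N + (n + m)) = (if b then v else \<not> v)"
      if "2 * dp \<le> t" for t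
      unfolding net_Suc using prim[OF that] by (auto simp: ls_def tau_def nA nB)
    have second: "?net (Suc (Suc t)) (if b then N + (n + m) else n + m) = (if b then \<not> v else v)"
      if "2 * dp \<le> t" for t
      unfolding net_Suc[of _ _ _ _ "Suc t"] using first[OF that] mN
      by (cases b) (simp_all add: ls_def tau_def nA nB node_val_def)
    have "t = Suc (Suc (t - 2))" "2 * dp \<le> t - 2"
      using less.prems(2) Gt by (auto simp: wire_depth_def dp_def)
    then obtain t' where t': "t = Suc (Suc t')" "2 * dp \<le> t'" by blast
    show ?thesis
      using first[of "Suc t'"] second[of t'] t' Gt by (cases b) (simp_all add: wire_val_def v_def)
  qed
qed

lemma gate_node_props:
  assumes "gate_node n N (g, ws) = (b, l, t)" "\<And>w. w \<in> set ws \<Longrightarrow> wire_index n w < N"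
  shows "set l \<subseteq> {..<2 * N}" "t \<le> length ws" "ac_gate g \<Longrightarrow> t = 0"
proof -
  have idx: "wire_index n ` set ws \<subseteq> {..<2 * N}" "(\<lambda>w. N + wire_index n w) ` set ws \<subseteq> {..<2 * N}"
    using assms(2) by fastforce+
  have "set l \<subseteq> {..<2 * N} \<and> t \<le> length ws \<and> (ac_gate g \<longrightarrow> t = 0)"
  proof (cases g)
    case (GThr t')
    with assms(1) idx show ?thesis by (cases t') (auto simp: ac_gate_def image_subset_iff)
  qed (use assms(1) idx in \<open>auto simp: ac_gate_def image_subset_iff\<close>)
  then show "set l \<subseteq> {..<2 * N}" "t \<le> length ws" "ac_gate g \<Longrightarrow> t = 0"
    by auto
qed

text \<open>The first two claims are hypotheses of \<open>threshold_net\<close>; the other two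
  determine the precision. The cap at the fan-in bounds every threshold by the circuit size, and
  AND, OR and NOT need only the threshold 0.\<close>

lemma circ_node_props:
  assumes ok: "gates_ok n C" and u: "u < 2 * (n + length C)"
  shows "set (fst (circ_node n C u)) \<subseteq> {..<2 * (n + length C) + n}"
    and "v \<in> set (fst (circ_node n C u)) \<Longrightarrow> 2 * (n + length C) \<le> v \<Longrightarrow> snd (circ_node n C u) = 0"
    and "snd (circ_node n C u) \<le> circ_size C"
    and "\<forall>gw\<in>set C. ac_gate (fst gw) \<Longrightarrow> snd (circ_node n C u) = 0"
proof -
  define N where "N = n + length C"
  have gate: "set l \<subseteq> {..<2 * N}" "t \<le> circ_size C" "\<forall>gw\<in>set C. ac_gate (fst gw) \<Longrightarrow> t = 0"
    if "gate_node n N (C ! m) = (b, l, t)" "m < length C" for m b l t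
  proof -
    obtain g ws where gw: "C ! m = (g, ws)" by fastforce
    have idx: "wire_index n w' < N" if "w' \<in> set ws" for w'
      using ok \<open>m < length C\<close> that gw by (cases w') (fastforce simp: gates_ok_def wire_ok_def N_def)+
    note p = gate_node_props[OF that(1)[unfolded gw] idx]
    show "set l \<subseteq> {..<2 * N}" using p by simp
    have "1 + length ws \<le> circ_size C"
      unfolding circ_size_def using gw that(2) nth_mem[OF that(2)]
      by (intro member_le_sum_list) (auto simp: image_iff intro!: bexI[of _ "C ! m"])
    then show "t \<le> circ_size C" using p by simp
    show "t = 0" if "\<forall>gw\<in>set C. ac_gate (fst gw)"
      using p(3) that nth_mem[OF \<open>m < length C\<close>] gw by fastforce
  qed
  define P where "P q \<longleftrightarrow> set (fst q) \<subseteq> {..<2 * N + n} \<and>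
     (v \<in> set (fst q) \<longrightarrow> 2 * N \<le> v \<longrightarrow> snd q = 0) \<and> snd q \<le> circ_size C \<and>
     ((\<forall>gw\<in>set C. ac_gate (fst gw)) \<longrightarrow> snd q = 0)" for q
  have P_single: "P ([w], 0)" if "w < 2 * N + n" for w
    using that by (simp add: P_def)
  have P_gate: "P (l, t)" if "set l \<subseteq> {..<2 * N}" "t \<le> circ_size C"
      "\<forall>gw\<in>set C. ac_gate (fst gw) \<Longrightarrow> t = 0" for l t
  proof -
    have "set l \<subseteq> {..<2 * N + n}" using that(1) by fastforce
    moreover have "\<not> (v \<in> set l \<and> 2 * N \<le> v)" using that(1) by auto
    ultimately show ?thesis using that(2,3) unfolding P_def fst_conv snd_conv by blast
  qed
  consider "u < n" | m where "u = n + m" "m < length C" | j where "u = N + j" "j < n"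
    | m where "u = N + (n + m)" "m < length C"
  proof -
    have "u < n \<or> (\<exists>m. u = n + m \<and> m < length C) \<or> (\<exists>j. u = N + j \<and> j < n)
      \<or> (\<exists>m. u = N + (n + m) \<and> m < length C)"
      using u unfolding N_def by presburger
    then show thesis using that by blast
  qed
  then have "P (circ_node n C u)"
  proof cases
    case 1
    then have "circ_node n C u = ([N + u], 0)"
      by (simp add: circ_node_def Let_def N_def)
    then show ?thesis using 1 by (auto intro!: P_single simp: N_def)
  next
    case (2 m)
    obtain b l t where gn: "gate_node n N (C ! m) = (b, l, t)" by (metis prod_cases3)
    have "n + m < N" using 2 by (simp add: N_def)
    then have "circ_node n C u = (if b then (l, t) else ([N + (n + m)], 0))"
      using 2 gn by (simp add: circ_node_def Let_def flip: N_def)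
    with \<open>n + m < N\<close> P_gate[OF gate[OF gn 2(2)]] P_single[of "N + (n + m)"] show ?thesis
      by (cases b) simp_all
  next
    case (3 j)
    then have "circ_node n C u = ([2 * N + j], 0)"
      by (simp add: circ_node_def Let_def flip: N_def)
    then show ?thesis using 3 by (auto intro!: P_single)
  next
    case (4 m)
    obtain b l t where gn: "gate_node n N (C ! m) = (b, l, t)" by (metis prod_cases3)
    have "n + m < N" using 4 by (simp add: N_def)
    have "circ_node n C u = (if b then ([n + m], 0) else (l, t))"
      using 4 gn by (simp add: circ_node_def Let_def flip: N_def)
    with \<open>n + m < N\<close> P_gate[OF gate[OF gn 4(2)]] P_single[of "n + m"] show ?thesis
      by (cases b) simp_all
  qed
  then show "set (fst (circ_node n C u)) \<subseteq> {..<2 * (n + length C) + n}"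
    "v \<in> set (fst (circ_node n C u)) \<Longrightarrow> 2 * (n + length C) \<le> v \<Longrightarrow> snd (circ_node n C u) = 0"
    "snd (circ_node n C u) \<le> circ_size C"
    "\<forall>gw\<in>set C. ac_gate (fst gw) \<Longrightarrow> snd (circ_node n C u) = 0"
    unfolding P_def N_def by blast+
qed

text \<open>The dimension is \<open>3 * R + 2 * n\<close> for \<open>R = 2 * (n + length C)\<close>
  nodes.\<close>

lemma circuit_to_looped_tf:
  assumes wf: "circ_wf n C" and np: "1 \<le> n" "1 \<le> p"
    and tau: "\<And>u. u < 2 * (n + length C) \<Longrightarrow> snd (circ_node n C u) + 2 \<le> 2 ^ p"
  obtains M where "lt_ok n M" "length (blk M) = 1" "\<forall>La\<in>set (blk M). length (heads La) = 1"
    "dim M = 8 * n + 6 * length C" "prec M = p" "iters M = 2 * circ_depth C + 2"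
    "\<And>x. length x = n \<Longrightarrow> lt_out M x = circ_out x C"
proof -
  have ok: "gates_ok n C" and ne: "C \<noteq> []" using wf by (auto simp: circ_wf_iff)
  let ?N = "n + length C"
  let ?ls = "\<lambda>u. fst (circ_node n C u)" and ?tau = "\<lambda>u. snd (circ_node n C u)"
  interpret threshold_net "2 * ?N" n p ?ls ?tau
    using np tau circ_node_props(1,2)[OF ok] by unfold_locales auto
  let ?T = "2 * circ_depth C + 2"
  let ?m = "length C - 1"
  let ?M = "net_tf (n + ?m) ?T"
  have m: "?m < length C" using ne by (cases C) auto
  show thesis
  proof (rule that[of ?M])
    show "lt_ok n ?M" by (rule net_tf_ok)
    fix x :: "bool list" assume "length x = n"
    then have "lt_out ?M x = net (2 * ?N) ?ls ?tau x ?T (n + ?m)"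
      using m by (intro net_tf_out) auto
    also have "\<dots> = wire_val x (circ_vals x C) (Gt ?m)"
      using net_circuit[OF ok, of "Gt ?m" ?T x] m gate_depths_le_circ_depth[OF m]
      by (simp add: wire_ok_def wire_depth_def)
    also have "circ_vals x C \<noteq> []"
      using ne length_circ_vals[of x C] by (metis length_0_conv)
    then have "wire_val x (circ_vals x C) (Gt ?m) = circ_out x C"
      by (simp add: circ_out_def wire_val_def last_conv_nth)
    finally show "lt_out ?M x = circ_out x C" .
  qed (unfold net_tf_def net_layer_def d_def, auto)
qed

section \<open>From circuit families to looped transformers\<close>

lemma logpow_nonneg: "0 \<le> logpow k n"
  by (simp add: logpow_def)

lemma length_le_circ_size: "length C \<le> circ_size C"
  unfolding circ_size_def by (induction C) auto

text \<open>A single constant \<open>6 * c + 8\<close> serves every bound in \<open>Loop\<close>.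
  The exponent \<open>Suc c\<close> absorbs the linear term \<open>8 * n\<close> even for
  \<open>c = 0\<close>.\<close>

lemma loop_bounds:
  fixes c n size :: nat
  assumes "1 \<le> n" "real size \<le> real c * real n ^ c + real c" "l \<le> size"
    "real D \<le> real c * logpow k n + real c"
  shows "real (8 * n + 6 * l) \<le> real (6 * c + 8) * real n ^ Suc c + real (6 * c + 8)"
    and "real (2 * D + 2) \<le> real (6 * c + 8) * logpow k n + real (6 * c + 8)"
proof -
  have "real n ^ c \<le> real n ^ Suc c" "real n ^ 1 \<le> real n ^ Suc c"
    using assms(1) by (intro power_increasing; simp)+
  then have "real c * real n ^ c \<le> real c * real n ^ Suc c" "real n \<le> real n ^ Suc c"
    by (auto intro: mult_left_mono)
  moreover have "real (8 * n + 6 * l) \<le> 8 * real n + 6 * (real c * real n ^ c + real c)"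
    using assms(2,3) by simp
  moreover have "real (6 * c + 8) * real n ^ Suc c = 6 * (real c * real n ^ Suc c) + 8 * real n ^ Suc c"
    by (simp add: algebra_simps)
  ultimately show "real (8 * n + 6 * l) \<le> real (6 * c + 8) * real n ^ Suc c + real (6 * c + 8)"
    by simp
  have "real (6 * c + 8) * logpow k n = 6 * (real c * logpow k n) + 8 * logpow k n"
    by (simp add: algebra_simps)
  moreover have "0 \<le> real c * logpow k n" by (simp add: logpow_nonneg)
  ultimately show "real (2 * D + 2) \<le> real (6 * c + 8) * logpow k n + real (6 * c + 8)"
    using assms(4) logpow_nonneg[of k n] by simp
qed

lemma AC_subset_Loop:
  assumes "L \<in> AC k"
  shows "\<exists>e. L \<in> Loop (logpow k) (\<lambda>n. real n ^ e) (\<lambda>n. 1)"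
proof -
  from assms obtain c :: nat where c: "\<And>n. \<exists>C. circ_wf n C \<and> (\<forall>gw\<in>set C. ac_gate (fst gw))
       \<and> real (circ_size C) \<le> real c * real n ^ c + real c
       \<and> real (circ_depth C) \<le> real c * logpow k n + real c
       \<and> (\<forall>x. length x = n \<longrightarrow> circ_out x C = L x)"
    unfolding AC_def by blast
  have "L \<in> Loop (logpow k) (\<lambda>n. real n ^ Suc c) (\<lambda>n. 1)"
    unfolding Loop_def mem_Collect_eq
  proof (intro exI[of _ "6 * c + 8"] allI impI)
    fix n :: nat assume n: "1 \<le> n"
    from c[of n] obtain C where C: "circ_wf n C" "\<forall>gw\<in>set C. ac_gate (fst gw)"
       "real (circ_size C) \<le> real c * real n ^ c + real c"
       "real (circ_depth C) \<le> real c * logpow k n + real c"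
       "\<forall>x. length x = n \<longrightarrow> circ_out x C = L x" by blast
    have ok: "gates_ok n C" using C(1) by (simp add: circ_wf_iff)
    \<comment> \<open>All thresholds are 0, so precision 1 is enough.\<close>
    have "snd (circ_node n C u) + 2 \<le> 2 ^ 1" if "u < 2 * (n + length C)" for u
      using circ_node_props(4)[OF ok that C(2)] by simp
    then obtain M where M: "lt_ok n M" "length (blk M) = 1" "\<forall>La\<in>set (blk M). length (heads La) = 1"
      "dim M = 8 * n + 6 * length C" "prec M = 1" "iters M = 2 * circ_depth C + 2"
      "\<And>x. length x = n \<Longrightarrow> lt_out M x = circ_out x C"
      using circuit_to_looped_tf[OF C(1) n order_refl] by metis
    show "\<exists>M. lt_ok n M \<and> length (blk M) \<le> 6 * c + 8 \<and> (\<forall>La\<in>set (blk M). length (heads La) \<le> 6 * c + 8) \<and>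
      real (dim M) \<le> real (6 * c + 8) * real n ^ Suc c + real (6 * c + 8) \<and>
      real (prec M) \<le> real (6 * c + 8) * 1 + real (6 * c + 8) \<and>
      real (iters M) \<le> real (6 * c + 8) * logpow k n + real (6 * c + 8) \<and>
      (\<forall>x. length x = n \<longrightarrow> lt_out M x = L x)"
      using M C(5) loop_bounds[OF n C(3) length_le_circ_size C(4)] by (intro exI[of _ M]) auto
  qed
  then show ?thesis by blast
qed

lemma TC_subset_Loop:
  assumes "L \<in> TC k"
  shows "\<exists>e. L \<in> Loop (logpow k) (\<lambda>n. real n ^ e) (logpow 1)"
proof -
  from assms obtain c :: nat where c: "\<And>n. \<exists>C. circ_wf n C
       \<and> real (circ_size C) \<le> real c * real n ^ c + real c
       \<and> real (circ_depth C) \<le> real c * logpow k n + real c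
       \<and> (\<forall>x. length x = n \<longrightarrow> circ_out x C = L x)"
    unfolding TC_def by blast
  have "L \<in> Loop (logpow k) (\<lambda>n. real n ^ Suc c) (logpow 1)"
    unfolding Loop_def mem_Collect_eq
  proof (intro exI[of _ "6 * c + 8"] allI impI)
    fix n :: nat assume n: "1 \<le> n"
    from c[of n] obtain C where C: "circ_wf n C"
       "real (circ_size C) \<le> real c * real n ^ c + real c"
       "real (circ_depth C) \<le> real c * logpow k n + real c"
       "\<forall>x. length x = n \<longrightarrow> circ_out x C = L x" by blast
    have ok: "gates_ok n C" using C(1) by (simp add: circ_wf_iff)
    \<comment> \<open>The least precision with \<open>circ_size C + 2 \<le> 2 ^ p\<close>;
      thresholds are at most \<open>circ_size C\<close>.\<close>
    define p where "p = nat \<lceil>log 2 (real (circ_size C + 2))\<rceil>"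
    have lg1: "1 \<le> log 2 (real (circ_size C + 2))"
      by (subst le_log_iff) auto
    then have "1 \<le> p" unfolding p_def by linarith
    have "real (circ_size C + 2) = 2 powr log 2 (real (circ_size C + 2))"
      by simp
    also have "\<dots> \<le> 2 powr real p"
      using lg1 by (intro powr_mono) (auto simp: p_def)
    finally have "real (circ_size C + 2) \<le> real (2 ^ p)"
      by (simp add: powr_realpow)
    then have "circ_size C + 2 \<le> 2 ^ p" by (simp only: of_nat_le_iff)
    then have "snd (circ_node n C u) + 2 \<le> 2 ^ p" if "u < 2 * (n + length C)" for u
      using circ_node_props(3)[OF ok that] by simp
    then obtain M where M: "lt_ok n M" "length (blk M) = 1" "\<forall>La\<in>set (blk M). length (heads La) = 1"
      "dim M = 8 * n + 6 * length C" "prec M = p" "iters M = 2 * circ_depth C + 2"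
      "\<And>x. length x = n \<Longrightarrow> lt_out M x = circ_out x C"
      using circuit_to_looped_tf[OF C(1) n \<open>1 \<le> p\<close>] by metis
    have "1 \<le> real n ^ c" using n by simp
    then have "real c * 1 \<le> real c * real n ^ c" by (intro mult_left_mono) auto
    then have "real (circ_size C + 2) \<le> real (2 * c + 2) * real n ^ c"
      using C(2) \<open>1 \<le> real n ^ c\<close> by (simp add: algebra_simps)
    \<comment> \<open>With a power of two as coefficient, its logarithm becomes the additive
      constant \<open>2 * c + 2\<close>.\<close>
    also have "\<dots> \<le> 2 ^ (2 * c + 2) * real n ^ c"
      using of_nat_less_two_power[of "2 * c + 2", where 'a = real] by (intro mult_right_mono) auto
    finally have "log 2 (real (circ_size C + 2)) \<le> log 2 (2 ^ (2 * c + 2) * real n ^ c)"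
      using n by (subst log_le_cancel_iff) auto
    also have "\<dots> = real (2 * c + 2) + real c * log 2 (real n)"
    proof -
      have "log 2 (2 ^ m * real n ^ c) = real m + real c * log 2 (real n)" for m
        using n by (simp add: log_mult log_nat_power)
      then show ?thesis .
    qed
    also have "log 2 (real n) = logpow 1 n"
      using n by (simp add: logpow_def max_def)
    finally have "real p \<le> real (2 * c + 3) + real c * logpow 1 n"
      using lg1 unfolding p_def by simp linarith
    moreover have "real c * logpow 1 n \<le> real (6 * c + 8) * logpow 1 n"
      by (intro mult_right_mono logpow_nonneg) simp
    ultimately have p: "real p \<le> real (6 * c + 8) * logpow 1 n + real (6 * c + 8)"
      by simp
    show "\<exists>M. lt_ok n M \<and> length (blk M) \<le> 6 * c + 8 \<and> (\<forall>La\<in>set (blk M). length (heads La) \<le> 6 * c + 8) \<and>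
      real (dim M) \<le> real (6 * c + 8) * real n ^ Suc c + real (6 * c + 8) \<and>
      real (prec M) \<le> real (6 * c + 8) * logpow 1 n + real (6 * c + 8) \<and>
      real (iters M) \<le> real (6 * c + 8) * logpow k n + real (6 * c + 8) \<and>
      (\<forall>x. length x = n \<longrightarrow> lt_out M x = L x)"
      using M C(4) p loop_bounds[OF n C(2) length_le_circ_size C(3)] by (intro exI[of _ M]) auto
  qed
  then show ?thesis by blast
qed

section \<open>Formulas and circuits\<close>

text \<open>The flag b permits threshold gates; K bounds the fan-in and a the depth.\<close>

inductive formula :: "bool \<Rightarrow> nat \<Rightarrow> nat \<Rightarrow> (bool list \<Rightarrow> bool) set \<Rightarrow> nat \<Rightarrow> (bool list \<Rightarrow> bool) \<Rightarrow> bool"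
  for b n K Fs where
  base: "f \<in> Fs \<Longrightarrow> (\<And>x. length x = n \<Longrightarrow> h x = f x) \<Longrightarrow> formula b n K Fs a h"
| gate: "(\<forall>f\<in>set fs. formula b n K Fs a f) \<Longrightarrow> length fs \<le> K \<Longrightarrow> b \<or> ac_gate g \<Longrightarrow>
    (g = GNot \<Longrightarrow> length fs = 1) \<Longrightarrow>
    (\<And>x. length x = n \<Longrightarrow> h x = gate_val g (map (\<lambda>f. f x) fs)) \<Longrightarrow> formula b n K Fs (Suc a) h"

definition computes :: "nat \<Rightarrow> circuit \<Rightarrow> nat \<Rightarrow> (bool list \<Rightarrow> bool) \<Rightarrow> bool" where
  "computes n C d f \<longleftrightarrow> (\<exists>w. wire_ok n (length C) w \<and> wire_depth (gate_depths C) w \<le> d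
     \<and> (\<forall>x. length x = n \<longrightarrow> wire_val x (circ_vals x C) w = f x))"

definition circ_ok :: "bool \<Rightarrow> nat \<Rightarrow> nat \<Rightarrow> circuit \<Rightarrow> bool" where
  "circ_ok b n D C \<longleftrightarrow> gates_ok n C \<and> circ_depth C \<le> D \<and> (\<forall>gw\<in>set C. b \<or> ac_gate (fst gw))"

lemma computes_append: "computes n C d f \<Longrightarrow> computes n (C @ E) d f"
proof -
  assume "computes n C d f"
  then obtain w where "wire_ok n (length C) w" "wire_depth (gate_depths C) w \<le> d"
    "\<forall>x. length x = n \<longrightarrow> wire_val x (circ_vals x C) w = f x"
    unfolding computes_def by blast
  then show ?thesis unfolding computes_def
    by (intro exI[of _ w]) (cases w;
      simp add: wire_ok_def wire_depth_def wire_val_def nth_append_circ_vals nth_append_gate_depths)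
qed

lemma circ_depth_le_iff: "circ_depth C \<le> D \<longleftrightarrow> (\<forall>i<length C. gate_depths C ! i \<le> D)"
  unfolding circ_depth_def by (subst Max_le_iff) (auto simp: set_conv_nth)

lemma circ_size_append: "circ_size (C @ E) = circ_size C + circ_size E"
  by (simp add: circ_size_def)

lemma add_gate:
  assumes C: "circ_ok b n D C" and fs: "\<forall>f\<in>set fs. computes n C d f" and D: "Suc d \<le> D"
    and g: "b \<or> ac_gate g" "g = GNot \<Longrightarrow> length fs = 1"
    and h: "\<And>x. length x = n \<Longrightarrow> h x = gate_val g (map (\<lambda>f. f x) fs)"
  obtains ws where "length ws = length fs" "circ_ok b n D (C @ [(g, ws)])"
    "\<And>x. length x = n \<Longrightarrow> circ_vals x (C @ [(g, ws)]) ! length C = h x"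
    "gate_depths (C @ [(g, ws)]) ! length C \<le> Suc d"
proof -
  from fs obtain W where W: "\<And>f. f \<in> set fs \<Longrightarrow> wire_ok n (length C) (W f)"
    "\<And>f. f \<in> set fs \<Longrightarrow> wire_depth (gate_depths C) (W f) \<le> d"
    "\<And>f x. f \<in> set fs \<Longrightarrow> length x = n \<Longrightarrow> wire_val x (circ_vals x C) (W f) = f x"
    unfolding computes_def by metis
  define ws where "ws = map W fs"
  let ?C = "C @ [(g, ws)]"
  have ok: "gates_ok n ?C"
    using C g(2) W(1) by (auto simp: circ_ok_def gates_ok_def nth_append ws_def less_Suc_eq)
  have W2: "wire_depth (gate_depths ?C) (W f) \<le> d" if "f \<in> set fs" for f
    using W(1,2)[OF that]
    by (auto simp: wire_depth_def wire_ok_def nth_append_gate_depths split: wire.splits)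
  have W3: "wire_val x (circ_vals x ?C) (W f) = f x" if "f \<in> set fs" "length x = n" for f x
    using W(1,3)[OF that(1)] that(2)
    by (auto simp: wire_val_def wire_ok_def nth_append_circ_vals split: wire.splits)
  have dep: "gate_depths ?C ! length C \<le> Suc d"
    using nth_gate_depths[OF ok, of "length C"] W2 by (auto simp: ws_def)
  then have "gate_depths ?C ! i \<le> D" if "i < length ?C" for i
    using that C D by (cases "i = length C")
      (auto simp: circ_ok_def circ_depth_le_iff nth_append_gate_depths less_Suc_eq)
  then have "circ_ok b n D ?C"
    using ok C g(1) by (auto simp: circ_ok_def circ_depth_le_iff)
  moreover have "circ_vals x ?C ! length C = h x" if "length x = n" for x
    using nth_circ_vals[OF ok, of "length C" x] W3 that
    by (simp add: ws_def h comp_def cong: map_cong)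
  ultimately show thesis
    using that[of ws] dep by (simp add: ws_def)
qed

text \<open>The formula is expanded as a tree over the wires for \<open>Fs\<close>. The summand 1 in
  the size bound pays, for each argument, for the wire into the parent gate; this leaves
  \<open>K * (K + 2) ^ a + 2\<close> for the whole gate.\<close>

lemma formula_circuit:
  assumes "formula b n K Fs a f"
    and "circ_ok b n D C" "\<forall>g\<in>Fs. computes n C d g" "d + a \<le> D"
  shows "\<exists>E. circ_ok b n D (C @ E) \<and> computes n (C @ E) (d + a) f \<and> circ_size E + 1 \<le> (K + 2) ^ a"
  using assms
proof (induction arbitrary: C rule: formula.induct)
  case (base f h a)
  then have "computes n C d f" by blast
  then have "computes n C (d + a) h"
    using base(2) unfolding computes_def by (metis trans_le_add1)
  then show ?case using base.prems by (intro exI[of _ "[]"]) (simp add: circ_size_def)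
next
  case (gate fs a g h)
  have "\<exists>E. circ_ok b n D (C @ E) \<and> (\<forall>f\<in>set fs'. computes n (C @ E) (d + a) f)
      \<and> circ_size E + length fs' \<le> length fs' * (K + 2) ^ a" if "set fs' \<subseteq> set fs" for fs'
    using that
  proof (induction fs')
    case Nil
    then show ?case using gate.prems by (intro exI[of _ "[]"]) (simp add: circ_size_def)
  next
    case (Cons f fs')
    then obtain E where E: "circ_ok b n D (C @ E)" "\<forall>f\<in>set fs'. computes n (C @ E) (d + a) f"
      "circ_size E + length fs' \<le> length fs' * (K + 2) ^ a" by auto
    have "\<forall>g\<in>Fs. computes n (C @ E) d g" using gate.prems by (auto intro: computes_append)
    with gate(1)[rule_format, of f] Cons.prems E(1) gate.prems
    obtain E' where E': "circ_ok b n D ((C @ E) @ E')" "computes n ((C @ E) @ E') (d + a) f"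
      "circ_size E' + 1 \<le> (K + 2) ^ a" by auto
    have "\<forall>g\<in>set (f # fs'). computes n (C @ (E @ E')) (d + a) g"
      using E(2) E'(2) computes_append[of n "C @ E" _ _ E'] by auto
    then show ?case using E E' by (intro exI[of _ "E @ E'"]) (auto simp: circ_size_append)
  qed
  from this[OF order_refl] obtain E where E: "circ_ok b n D (C @ E)"
      "\<forall>f\<in>set fs. computes n (C @ E) (d + a) f"
      "circ_size E + length fs \<le> length fs * (K + 2) ^ a" by auto
  have "Suc (d + a) \<le> D" using gate.prems by simp
  from add_gate[OF E(1,2) this gate(3-5)]
  obtain ws where ws: "length ws = length fs" "circ_ok b n D ((C @ E) @ [(g, ws)])"
    "\<And>x. length x = n \<Longrightarrow> circ_vals x ((C @ E) @ [(g, ws)]) ! length (C @ E) = h x"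
    "gate_depths ((C @ E) @ [(g, ws)]) ! length (C @ E) \<le> Suc (d + a)" by blast
  have "computes n ((C @ E) @ [(g, ws)]) (d + Suc a) h"
    unfolding computes_def using ws(3,4)
    by (intro exI[of _ "Gt (length (C @ E))"])
       (simp add: wire_ok_def wire_depth_def wire_val_def)
  moreover have "circ_size (E @ [(g, ws)]) + 1 \<le> (K + 2) ^ Suc a"
  proof -
    have "circ_size (E @ [(g, ws)]) + 1 \<le> length fs * (K + 2) ^ a + 2"
      using E(3) ws(1) by (simp add: circ_size_def)
    also have "\<dots> \<le> K * (K + 2) ^ a + 2 * (K + 2) ^ a"
      using gate(2) by (intro add_mono mult_right_mono) auto
    finally show ?thesis by (simp add: algebra_simps)
  qed
  ultimately show ?case using ws(2) by (intro exI[of _ "E @ [(g, ws)]"]) simp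
qed

lemma formulas_circuit:
  assumes "circ_ok b n D C" "\<forall>g\<in>Fs. computes n C d g" "d + a \<le> D"
    "\<forall>f\<in>set gs. formula b n K Fs a f"
  shows "\<exists>E. circ_ok b n D (C @ E) \<and> (\<forall>f\<in>set gs. computes n (C @ E) (d + a) f)
    \<and> circ_size E \<le> length gs * (K + 2) ^ a"
  using assms(4)
proof (induction gs)
  case Nil
  then show ?case using assms by (intro exI[of _ "[]"]) (simp add: circ_size_def)
next
  case (Cons f gs)
  then obtain E where E: "circ_ok b n D (C @ E)" "\<forall>f\<in>set gs. computes n (C @ E) (d + a) f"
    "circ_size E \<le> length gs * (K + 2) ^ a" by auto
  have "\<forall>g\<in>Fs. computes n (C @ E) d g" using assms by (auto intro: computes_append)
  with formula_circuit[of b n K Fs a f D "C @ E" d] Cons.prems E(1) assms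
  obtain E' where E': "circ_ok b n D ((C @ E) @ E')" "computes n ((C @ E) @ E') (d + a) f"
    "circ_size E' + 1 \<le> (K + 2) ^ a" by auto
  have "\<forall>g\<in>set (f # gs). computes n (C @ (E @ E')) (d + a) g"
    using E(2) E'(2) computes_append[of n "C @ E" _ _ E'] by auto
  then show ?case using E E' by (intro exI[of _ "E @ E'"]) (auto simp: circ_size_append)
qed

lemma circ_ok_mono: "circ_ok b n D C \<Longrightarrow> D \<le> D' \<Longrightarrow> circ_ok b n D' C"
  by (auto simp: circ_ok_def)

text \<open>The wires for one stage are the base functions of the next and are reused there. So the
  number of stages enters the size as a factor, and only the constant depth \<open>a\<close> of one
  stage as an exponent.\<close>

lemma formula_stages_circuit:
  assumes "\<forall>f\<in>set (Gs 0). \<exists>j<n. \<forall>x. length x = n \<longrightarrow> f x = x ! j"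
    and "\<And>t f. t < T \<Longrightarrow> f \<in> set (Gs (Suc t)) \<Longrightarrow> formula b n K (set (Gs t)) a f"
    and "\<And>t. t \<le> T \<Longrightarrow> length (Gs t) \<le> B"
  shows "\<exists>C. circ_ok b n (a * T) C \<and> (\<forall>f\<in>set (Gs T). computes n C (a * T) f)
    \<and> circ_size C \<le> T * (B * (K + 2) ^ a)"
proof -
  have "t \<le> T \<longrightarrow> (\<exists>C. circ_ok b n (a * t) C \<and> (\<forall>f\<in>set (Gs t). computes n C (a * t) f)
    \<and> circ_size C \<le> t * (B * (K + 2) ^ a))" for t
  proof (induction t)
    case 0
    have "computes n [] 0 f" if "f \<in> set (Gs 0)" for f
    proof -
      from bspec[OF assms(1) that] obtain j where "j < n" "\<forall>x. length x = n \<longrightarrow> f x = x ! j" by auto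
      then show ?thesis
        unfolding computes_def by (intro exI[of _ "Inp j"]) (simp add: wire_ok_def wire_depth_def wire_val_def)
    qed
    then show ?case
      by (intro impI exI[of _ "[]"]) (simp add: circ_ok_def gates_ok_def circ_depth_def gate_depths_def circ_size_def)
  next
    case (Suc t)
    show ?case
    proof
      assume t: "Suc t \<le> T"
      with Suc.IH obtain C where C: "circ_ok b n (a * t) C" "\<forall>f\<in>set (Gs t). computes n C (a * t) f"
        "circ_size C \<le> t * (B * (K + 2) ^ a)" by auto
      have ok: "circ_ok b n (a * Suc t) C" using C(1) by (rule circ_ok_mono) simp
      have le: "a * t + a \<le> a * Suc t" by simp
      have "\<forall>f\<in>set (Gs (Suc t)). formula b n K (set (Gs t)) a f" using assms(2) t by simp
      from formulas_circuit[OF ok C(2) le this] obtain E where E: "circ_ok b n (a * Suc t) (C @ E)"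
        "\<forall>f\<in>set (Gs (Suc t)). computes n (C @ E) (a * t + a) f"
        "circ_size E \<le> length (Gs (Suc t)) * (K + 2) ^ a" by auto
      have "length (Gs (Suc t)) * (K + 2) ^ a \<le> B * (K + 2) ^ a"
        using assms(3)[OF t] by (rule mult_right_mono) simp
      then have "circ_size (C @ E) \<le> Suc t * (B * (K + 2) ^ a)"
        using C(3) E(3) unfolding circ_size_append mult_Suc by linarith
      with E show "\<exists>C. circ_ok b n (a * Suc t) C \<and> (\<forall>f\<in>set (Gs (Suc t)). computes n C (a * Suc t) f)
        \<and> circ_size C \<le> Suc t * (B * (K + 2) ^ a)"
        by (intro exI[of _ "C @ E"]) (simp add: add.commute)
    qed
  qed
  then show ?thesis by simp
qed

lemma formula_stages_decide:
  assumes "\<forall>f\<in>set (Gs 0). \<exists>j<n. \<forall>x. length x = n \<longrightarrow> f x = x ! j"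
    and "\<And>t f. t < T \<Longrightarrow> f \<in> set (Gs (Suc t)) \<Longrightarrow> formula b n K (set (Gs t)) a f"
    and "\<And>t. t \<le> T \<Longrightarrow> length (Gs t) \<le> B"
    and "L \<in> set (Gs T)"
  shows "\<exists>C. circ_wf n C \<and> (\<forall>gw\<in>set C. b \<or> ac_gate (fst gw))
    \<and> circ_size C \<le> T * (B * (K + 2) ^ a) + 2 \<and> circ_depth C \<le> a * T + 1
    \<and> (\<forall>x. length x = n \<longrightarrow> circ_out x C = L x)"
proof -
  obtain C where C: "circ_ok b n (a * T) C" "computes n C (a * T) L"
    "circ_size C \<le> T * (B * (K + 2) ^ a)"
    using formula_stages_circuit[where Gs = Gs and T = T and B = B, OF assms(1-3)] assms(4) by blast
  have ok: "circ_ok b n (a * T + 1) C" using C(1) by (rule circ_ok_mono) simp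
  \<comment> \<open>\<open>circ_out\<close> reads the last gate, but \<open>L\<close> may be carried
    by any gate or by an input. Hence an OR gate with this single source is appended, at cost 2 in
    size and 1 in depth.\<close>
  have "\<forall>f\<in>set [L]. computes n C (a * T) f" "Suc (a * T) \<le> a * T + 1" "b \<or> ac_gate GOr"
    using C(2) by (auto simp: ac_gate_def)
  from add_gate[OF ok this, of L] obtain ws where ws: "length ws = 1"
    "circ_ok b n (a * T + 1) (C @ [(GOr, ws)])"
    "\<And>x. length x = n \<Longrightarrow> circ_vals x (C @ [(GOr, ws)]) ! length C = L x"
    by (auto simp: gate_val_def)
  have "circ_out x (C @ [(GOr, ws)]) = circ_vals x (C @ [(GOr, ws)]) ! length C" for x
  proof -
    have "circ_vals x (C @ [(GOr, ws)]) \<noteq> []"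
      using length_circ_vals[of x "C @ [(GOr, ws)]"] by (metis length_0_conv snoc_eq_iff_butlast)
    then show ?thesis by (simp add: circ_out_def last_conv_nth)
  qed
  with ws C(3) show ?thesis
    by (intro exI[of _ "C @ [(GOr, ws)]"])
       (auto simp: circ_ok_def circ_wf_iff circ_size_append circ_size_def)
qed

section \<open>Clamped walks\<close>

definition clamp_add :: "int \<Rightarrow> int \<Rightarrow> int \<Rightarrow> int \<Rightarrow> int" where
  "clamp_add l M y a = max l (min M (y + a))"

text \<open>Read backwards from the end, the clamped walk ends at or above t iff the suffix sums bring the
  requirement t below the lower barrier, or below the start value, before it exceeds the upper one.\<close>

lemma clamped_walk_ge_iff:
  assumes "0 \<le> M"
  shows "t \<le> foldl (clamp_add (- M) M) 0 as \<longleftrightarrow>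
    (\<exists>i\<in>{..length as}. t - sum_list (drop i as) \<le> (if i = 0 then 0 else - M)
       \<and> (\<forall>j\<in>{i..length as}. t - sum_list (drop j as) \<le> M))"
proof (induction as arbitrary: t rule: rev_induct)
  case Nil
  show ?case using assms by auto
next
  case (snoc a as)
  let ?m = "length as"
  let ?P = "\<lambda>as t i. t - sum_list (drop i as) \<le> (if i = 0 then 0 else - M)"
  let ?Q = "\<lambda>as t j. t - sum_list (drop j as) \<le> M"
  have drop: "t - sum_list (drop j (as @ [a])) = (t - a) - sum_list (drop j as)" if "j \<le> ?m" for j
    using that by simp
  have split: "(\<exists>i\<in>{..Suc m}. P i \<and> (\<forall>j\<in>{i..Suc m}. Q j)) \<longleftrightarrow>
      Q (Suc m) \<and> (P (Suc m) \<or> (\<exists>i\<in>{..m}. P i \<and> (\<forall>j\<in>{i..m}. Q j)))" for P Q :: "nat \<Rightarrow> bool" and m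
  proof -
    have "{..Suc m} = insert (Suc m) {..m}" by auto
    moreover have "(\<forall>j\<in>{i..Suc m}. Q j) \<longleftrightarrow> Q (Suc m) \<and> (\<forall>j\<in>{i..m}. Q j)" if "i \<in> {..m}" for i
    proof -
      have "{i..Suc m} = insert (Suc m) {i..m}" using that by auto
      then show ?thesis by simp
    qed
    ultimately show ?thesis by auto
  qed
  \<comment> \<open>One step backwards: unless the lower barrier grants \<open>t\<close> or the
    upper one excludes it, the requirement one step earlier is \<open>t - a\<close>.\<close>
  have "t \<le> foldl (clamp_add (- M) M) 0 (as @ [a]) \<longleftrightarrow>
      t \<le> - M \<or> t \<le> M \<and> t - a \<le> foldl (clamp_add (- M) M) 0 as"
    using assms by (auto simp: clamp_add_def)
  also have "\<dots> \<longleftrightarrow> t \<le> - M \<or> t \<le> M \<and> (\<exists>i\<in>{..?m}. ?P as (t - a) i \<and> (\<forall>j\<in>{i..?m}. ?Q as (t - a) j))"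
    unfolding snoc ..
  also have "(\<exists>i\<in>{..?m}. ?P as (t - a) i \<and> (\<forall>j\<in>{i..?m}. ?Q as (t - a) j)) \<longleftrightarrow>
      (\<exists>i\<in>{..?m}. ?P (as @ [a]) t i \<and> (\<forall>j\<in>{i..?m}. ?Q (as @ [a]) t j))"
    by (intro bex_cong conj_cong ball_cong refl) (simp_all only: drop atMost_iff atLeastAtMost_iff)
  also have "t \<le> - M \<or> t \<le> M \<and> (\<exists>i\<in>{..?m}. ?P (as @ [a]) t i \<and> (\<forall>j\<in>{i..?m}. ?Q (as @ [a]) t j))
      \<longleftrightarrow> (\<exists>i\<in>{..Suc ?m}. ?P (as @ [a]) t i \<and> (\<forall>j\<in>{i..Suc ?m}. ?Q (as @ [a]) t j))"
  proof -
    have imp: "t \<le> - M \<Longrightarrow> t \<le> M" using assms by simp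
    have PQ: "?P (as @ [a]) t (Suc ?m) \<longleftrightarrow> t \<le> - M" "?Q (as @ [a]) t (Suc ?m) \<longleftrightarrow> t \<le> M"
      by simp_all
    show ?thesis unfolding split PQ using imp by blast
  qed
  finally show ?case by simp
qed

text \<open>The lower barrier is a parameter because the walk is built up from the barrier
  \<open>M\<close>, where it is constant, down to \<open>- M\<close>, where it is the clamped sum.
  The start \<open>max 0 l\<close> keeps it between the barriers for every \<open>l\<close> up to
  \<open>M\<close>.\<close>

definition walk :: "int \<Rightarrow> int \<Rightarrow> (nat \<Rightarrow> int) \<Rightarrow> nat \<Rightarrow> int" where
  "walk M l f i = foldl (clamp_add l M) (max 0 l) (map f [0..<i])"

lemma walk_0 [simp]: "walk M l f 0 = max 0 l"
  and walk_Suc [simp]: "walk M l f (Suc i) = max l (min M (walk M l f i + f i))"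
  by (simp_all add: walk_def clamp_add_def)

lemma walk_bounds: "0 \<le> M \<Longrightarrow> l \<le> M \<Longrightarrow> l \<le> walk M l f i \<and> walk M l f i \<le> M"
  by (induction i) auto

text \<open>Raising the lower barrier by one raises the walk by at most one; the difference is a bit that is
  set at the lower barrier, reset at the upper barrier and kept otherwise.\<close>

lemma walk_barrier_step:
  assumes "0 \<le> M" "l < M"
  shows "walk M l f i = walk M (l + 1) f i -
    of_bool ((\<exists>j\<in>{..<i}. walk M (l + 1) f j + f j \<le> l \<and> (\<forall>k\<in>{j<..<i}. walk M (l + 1) f k + f k \<le> M))
      \<or> 0 \<le> l \<and> (\<forall>k\<in>{..<i}. walk M (l + 1) f k + f k \<le> M))"
proof (induction i)
  case 0
  then show ?case by auto
next
  case (Suc i)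
  define w where "w j = walk M (l + 1) f j + f j" for j
  \<comment> \<open>The unrolled set/reset bit: some set event has no later reset, or the initial
    bit was never reset. The initial bit is 1 iff \<open>0 \<le> l\<close>, for just then
    \<open>max 0 l\<close> and \<open>max 0 (l + 1)\<close> differ.\<close>
  define \<delta> where "\<delta> i \<longleftrightarrow> (\<exists>j\<in>{..<i}. w j \<le> l \<and> (\<forall>k\<in>{j<..<i}. w k \<le> M)) \<or> 0 \<le> l \<and> (\<forall>k\<in>{..<i}. w k \<le> M)" for i
  have ivl: "{j<..<Suc i} = insert i {j<..<i}" if "j < i" for j using that by auto
  have \<delta>: "\<delta> (Suc i) \<longleftrightarrow> w i \<le> l \<or> w i \<le> M \<and> \<delta> i"
    unfolding \<delta>_def lessThan_Suc bex_simps using assms by (auto simp: ivl)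
  have "walk M l f i = walk M (l + 1) f i - of_bool (\<delta> i)"
    using Suc.IH by (simp only: \<delta>_def w_def)
  then have "walk M l f (Suc i) = walk M (l + 1) f (Suc i) - of_bool (\<delta> (Suc i))"
    using assms unfolding \<delta> by (auto simp: w_def)
  then show ?case by (simp only: \<delta>_def w_def)
qed

section \<open>One-hot arithmetic with formulas\<close>

lemma formula_mono: "formula b n K Fs a f \<Longrightarrow> a \<le> a' \<Longrightarrow> formula b n K Fs a' f"
proof (induction arbitrary: a' rule: formula.induct)
  case (base f h a)
  then show ?case by (intro formula.base) auto
next
  case (gate fs a g h)
  then obtain a'' where a': "a' = Suc a''" "a \<le> a''" by (cases a') auto
  show ?case unfolding a'(1) using gate a'(2) by (intro formula.gate[where fs = fs and g = g]) auto
qed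

lemma formula_cong:
  assumes "\<And>x. length x = n \<Longrightarrow> f x = g x"
  shows "formula b n K Fs a f \<longleftrightarrow> formula b n K Fs a g"
proof -
  have "formula b n K Fs a g" if "formula b n K Fs a f" "\<And>x. length x = n \<Longrightarrow> f x = g x" for f g
    using that(1)
  proof cases
    case (base f')
    then show ?thesis using that(2) by (intro formula.base[of f']) auto
  next
    case (gate fs a' g')
    show ?thesis unfolding gate(1)
      by (rule formula.gate[of fs _ _ _ _ _ g']) (use gate that(2) in auto)
  qed
  then show ?thesis using assms by metis
qed

text \<open>Numerators range over \<open>{- M..M}\<close>; the fan-in \<open>K\<close> must allow a
  disjunction over all pairs of them, which is what a table of a binary operation needs.\<close>

locale formula_calculus =
  fixes b :: bool and n K :: nat and Fs :: "(bool list \<Rightarrow> bool) set" and M :: int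
  assumes M_nonneg: "0 \<le> M" and K_ge2: "2 \<le> K" and K_ge: "(2 * M + 1)\<^sup>2 \<le> int K"
begin

abbreviation fm :: "nat \<Rightarrow> (bool list \<Rightarrow> bool) \<Rightarrow> bool" where "fm \<equiv> formula b n K Fs"

lemma fm_list:
  assumes "\<forall>f\<in>set fs. fm a f" "length fs \<le> K"
  shows "fm (Suc a) (\<lambda>x. \<exists>f\<in>set fs. f x)" "fm (Suc a) (\<lambda>x. \<forall>f\<in>set fs. f x)"
proof -
  show "fm (Suc a) (\<lambda>x. \<exists>f\<in>set fs. f x)"
    by (rule formula.gate[of fs _ _ _ _ _ GOr])
       (use assms in \<open>auto simp: ac_gate_def gate_val_def list_ex_iff\<close>)
  show "fm (Suc a) (\<lambda>x. \<forall>f\<in>set fs. f x)"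
    by (rule formula.gate[of fs _ _ _ _ _ GAnd])
       (use assms in \<open>auto simp: ac_gate_def gate_val_def list_all_iff\<close>)
qed

lemma fm_bex:
  assumes "finite I" "card I \<le> K" "\<And>i. i \<in> I \<Longrightarrow> fm a (f i)"
  shows "fm (Suc a) (\<lambda>x. \<exists>i\<in>I. f i x)"
    and fm_ball: "fm (Suc a) (\<lambda>x. \<forall>i\<in>I. f i x)"
proof -
  obtain js where js: "set js = I" "distinct js" using finite_distinct_list[OF assms(1)] by auto
  then have "length js \<le> K" using assms(2) by (metis distinct_card)
  then show "fm (Suc a) (\<lambda>x. \<exists>i\<in>I. f i x)" "fm (Suc a) (\<lambda>x. \<forall>i\<in>I. f i x)"
    using fm_list[of "map f js" a] assms(3) js by auto
qed

lemma fm_const: "fm (Suc a) (\<lambda>x. c)"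
  using fm_bex[of "{}" a] fm_ball[of "{}" a] by (cases c) auto

lemma fm_not: "fm a f \<Longrightarrow> fm (Suc a) (\<lambda>x. \<not> f x)"
  by (rule formula.gate[of "[f]" _ _ _ _ _ GNot])
     (use K_ge2 in \<open>auto simp: ac_gate_def gate_val_def\<close>)

lemma fm_conj: "fm a f \<Longrightarrow> fm a g \<Longrightarrow> fm (Suc a) (\<lambda>x. f x \<and> g x)"
  and fm_disj: "fm a f \<Longrightarrow> fm a g \<Longrightarrow> fm (Suc a) (\<lambda>x. f x \<or> g x)"
  using fm_list[of "[f, g]" a] K_ge2 by auto

definition onehot :: "nat \<Rightarrow> (bool list \<Rightarrow> int) \<Rightarrow> bool" where
  "onehot a k \<longleftrightarrow> (\<forall>x. length x = n \<longrightarrow> \<bar>k x\<bar> \<le> M) \<and> (\<forall>c. \<bar>c\<bar> \<le> M \<longrightarrow> fm a (\<lambda>x. k x = c))"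

lemma onehot_mono: "onehot a k \<Longrightarrow> a \<le> a' \<Longrightarrow> onehot a' k"
  by (auto simp: onehot_def intro: formula_mono)

lemma onehot_range: "onehot a k \<Longrightarrow> length x = n \<Longrightarrow> k x \<in> {- M..M}"
proof -
  assume "onehot a k" "length x = n"
  then have "\<bar>k x\<bar> \<le> M" by (simp add: onehot_def)
  then show ?thesis by auto
qed

lemma card_values: "card {- M..M} \<le> K" "card ({- M..M} \<times> {- M..M}) \<le> K"
proof -
  have c: "int (card {- M..M}) = 2 * M + 1" using M_nonneg by simp
  have "int (card ({- M..M} \<times> {- M..M})) = (2 * M + 1)\<^sup>2"
    by (simp only: card_cartesian_product of_nat_mult c power2_eq_square)
  with K_ge show 2: "card ({- M..M} \<times> {- M..M}) \<le> K" by linarith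
  have "card {- M..M} * 1 \<le> card {- M..M} * card {- M..M}"
    using c M_nonneg by (intro mult_left_mono) linarith+
  then show "card {- M..M} \<le> K" using 2 by (simp only: card_cartesian_product)
qed

lemma fm_pred:
  assumes "onehot a k"
  shows "fm (Suc a) (\<lambda>x. P (k x))"
proof -
  let ?I = "{- M..M} \<inter> Collect P"
  have "card ?I \<le> card {- M..M}" by (intro card_mono) auto
  with card_values(1) have "card ?I \<le> K" by linarith
  then have "fm (Suc a) (\<lambda>x. \<exists>c\<in>?I. k x = c)"
    using assms by (intro fm_bex) (auto simp: onehot_def)
  then show ?thesis
    by (rule formula_cong[THEN iffD1, rotated]) (use onehot_range[OF assms] in auto)
qed

lemma fm_pred2:
  assumes "onehot a k" "onehot a l"
  shows "fm (a + 2) (\<lambda>x. P (k x) (l x))"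
proof -
  let ?I = "({- M..M} \<times> {- M..M}) \<inter> {c. P (fst c) (snd c)}"
  have "card ?I \<le> card ({- M..M} \<times> {- M..M})" by (intro card_mono) auto
  with card_values(2) have "card ?I \<le> K" by linarith
  then have "fm (Suc (Suc a)) (\<lambda>x. \<exists>c\<in>?I. k x = fst c \<and> l x = snd c)"
    using assms by (intro fm_bex fm_conj) (auto simp: onehot_def)
  then have "fm (a + 2) (\<lambda>x. \<exists>c\<in>?I. k x = fst c \<and> l x = snd c)" by simp
  then show ?thesis
    by (rule formula_cong[THEN iffD1, rotated]) (use onehot_range[OF assms(1)] onehot_range[OF assms(2)] in force)
qed

lemma onehot_const: "\<bar>c\<bar> \<le> M \<Longrightarrow> onehot (Suc a) (\<lambda>x. c)"
  by (simp add: onehot_def fm_const)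

lemma onehot_op2:
  assumes "onehot a k" "onehot a l" "\<And>u v. \<bar>u\<bar> \<le> M \<Longrightarrow> \<bar>v\<bar> \<le> M \<Longrightarrow> \<bar>f u v\<bar> \<le> M"
  shows "onehot (a + 2) (\<lambda>x. f (k x) (l x))"
  using fm_pred2[OF assms(1,2)] assms by (auto simp: onehot_def)

section \<open>Formulas for clamped sums\<close>

lemma length_filter_le_upto: "0 \<le> v \<Longrightarrow> v \<le> m \<Longrightarrow> length (filter (\<lambda>c. c \<le> v) [1..m]) = nat v"
proof -
  assume v: "0 \<le> v" "v \<le> m"
  have "distinct (filter (\<lambda>c. c \<le> v) [1..m])" by simp
  then have "length (filter (\<lambda>c. c \<le> v) [1..m]) = card (set (filter (\<lambda>c. c \<le> v) [1..m]))"
    by (rule distinct_card[symmetric])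
  also have "set (filter (\<lambda>c. c \<le> v) [1..m]) = {1..v}" using v by auto
  finally show ?thesis by simp
qed

text \<open>In unary, \<open>k x + M\<close> is the number of \<open>c\<close> in
  \<open>[1..2 * M]\<close> with \<open>c \<le> k x + M\<close>. So the shifted sum is a number of
  true bits, which one threshold gate compares with a constant; where \<open>nat\<close> turns a
  negative threshold into 0, both sides hold.\<close>

lemma fm_sum_ge:
  assumes b and "\<forall>k\<in>set ks. onehot a k" "int (length ks) * (2 * M) \<le> int K"
  shows "fm (a + 2) (\<lambda>x. s \<le> sum_list (map (\<lambda>k. k x) ks))"
proof -
  let ?bits = "\<lambda>k. map (\<lambda>c x. c \<le> k x + M) [1..2 * M]"
  define fs where "fs = concat (map ?bits ks)"
  have len: "int (length fs) = int (length ks) * (2 * M)"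
    unfolding fs_def using M_nonneg by (induction ks) (auto simp: algebra_simps)
  have cnt: "int (length (filter id (map (\<lambda>f. f x) fs))) = sum_list (map (\<lambda>k. k x) ks) + int (length ks) * M"
    if "length x = n" for x
    using assms(2) unfolding fs_def
  proof (induction ks)
    case (Cons k ks)
    have "\<bar>k x\<bar> \<le> M" using Cons.prems that by (auto simp: onehot_def)
    then have "int (length (filter (\<lambda>c. c \<le> k x + M) [1..2 * M])) = k x + M"
      by (subst length_filter_le_upto) auto
    then have bits: "int (length (filter id (map (\<lambda>f. f x) (?bits k)))) = k x + M"
      by (simp add: comp_def filter_map)
    have "int (length (filter id (map (\<lambda>f. f x) (concat (map ?bits (k # ks)))))) =
        k x + M + (sum_list (map (\<lambda>k. k x) ks) + int (length ks) * M)"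
    proof -
      have "int (length (filter id (map (\<lambda>f. f x) (concat (map ?bits ks))))) =
          sum_list (map (\<lambda>k. k x) ks) + int (length ks) * M"
        by (rule Cons.IH) (use Cons.prems in auto)
      with bits show ?thesis
        by (simp only: list.map concat.simps map_append filter_append length_append of_nat_add)
    qed
    also have "\<dots> = sum_list (map (\<lambda>k. k x) (k # ks)) + int (length (k # ks)) * M"
      by (simp add: algebra_simps)
    finally show ?case .
  qed simp
  have "fm (Suc (Suc a)) (\<lambda>x. s \<le> sum_list (map (\<lambda>k. k x) ks))"
  proof (rule formula.gate[of fs _ _ _ _ _ "GThr (nat (s + int (length ks) * M))"])
    show "\<forall>f\<in>set fs. fm (Suc a) f"
    proof
      fix f assume "f \<in> set fs"
      then obtain k c where "k \<in> set ks" "f = (\<lambda>x. c \<le> k x + M)" by (auto simp: fs_def)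
      then show "fm (Suc a) f" using assms(2) fm_pred[of a k "\<lambda>v. c \<le> v + M"] by simp
    qed
    show "length fs \<le> K" using len assms(3) by linarith
    show "(s \<le> sum_list (map (\<lambda>k. k x) ks)) =
        gate_val (GThr (nat (s + int (length ks) * M))) (map (\<lambda>f. f x) fs)" if "length x = n" for x
      unfolding gate_val_def gate.case nat_le_iff cnt[OF that] by auto
  qed (use assms(1) in auto)
  then show ?thesis by simp
qed

text \<open>Seven levels: two to compare suffix sums, three for the quantifiers of
  \<open>clamped_walk_ge_iff\<close>, and two for equality with \<open>c\<close> as "at least
  \<open>c\<close> but not at least \<open>c + 1\<close>".\<close>

lemma onehot_clamped_sum_threshold:
  assumes b and ks: "\<forall>k\<in>set ks. onehot a k" and len: "int (length ks) * (2 * M) \<le> int K" "length ks < K"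
  shows "onehot (a + 7) (\<lambda>x. foldl (clamp_add (- M) M) 0 (map (\<lambda>k. k x) ks))"
proof -
  let ?Y = "\<lambda>x. foldl (clamp_add (- M) M) 0 (map (\<lambda>k. k x) ks)"
  let ?m = "length ks"
  have suf: "fm (a + 2) (\<lambda>x. t - sum_list (drop j (map (\<lambda>k. k x) ks)) \<le> s)" for t s j
  proof -
    have "int (length (drop j ks)) * (2 * M) \<le> int ?m * (2 * M)"
      using M_nonneg by (intro mult_right_mono) auto
    with len have "int (length (drop j ks)) * (2 * M) \<le> int K" by linarith
    with ks have "fm (a + 2) (\<lambda>x. t - s \<le> sum_list (map (\<lambda>k. k x) (drop j ks)))"
      by (intro fm_sum_ge assms(1)) (auto dest: in_set_dropD)
    then show ?thesis by (simp add: drop_map algebra_simps)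
  qed
  have ge: "fm (a + 5) (\<lambda>x. t \<le> ?Y x)" for t
  proof -
    have "fm (Suc (Suc (Suc (a + 2)))) (\<lambda>x. \<exists>i\<in>{..?m}. t - sum_list (drop i (map (\<lambda>k. k x) ks)) \<le> (if i = 0 then 0 else - M)
       \<and> (\<forall>j\<in>{i..?m}. t - sum_list (drop j (map (\<lambda>k. k x) ks)) \<le> M))"
      using len(2) by (intro fm_bex fm_conj fm_ball suf formula_mono[OF suf]) auto
    moreover have "Suc (Suc (Suc (a + 2))) = a + 5" by simp
    ultimately show ?thesis by (simp only: clamped_walk_ge_iff[OF M_nonneg] length_map)
  qed
  have "fm (Suc (Suc (a + 5))) (\<lambda>x. c \<le> ?Y x \<and> \<not> (c + 1 \<le> ?Y x))" for c
    by (intro fm_conj fm_not ge formula_mono[OF ge]) auto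
  moreover have "(c \<le> y \<and> \<not> (c + 1 \<le> y)) = (y = c)" for c y :: int by auto
  moreover have "Suc (Suc (a + 5)) = a + 7" by simp
  ultimately have "fm (a + 7) (\<lambda>x. ?Y x = c)" for c by (simp only:)
  moreover have "\<bar>foldl (clamp_add (- M) M) 0 as\<bar> \<le> M" for as
    using M_nonneg by (induction as rule: rev_induct) (auto simp: clamp_add_def)
  ultimately show ?thesis by (simp add: onehot_def)
qed

text \<open>Induction on the distance \<open>N\<close> of the barrier from \<open>M\<close>; for
  \<open>N = 0\<close> the walk is constant. Each further unit costs nine levels: two to look up
  \<open>walk + f\<close>, four to form the set/reset bit, and three to choose between the values
  \<open>c + 1\<close> and \<open>c\<close> of the walk with the higher barrier.\<close>

lemma fm_walk:
  assumes ks: "\<And>i. i < m \<Longrightarrow> onehot a (\<lambda>x. f x i)" and m: "m < K"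
  shows "int N \<le> 2 * M \<Longrightarrow> i \<le> m \<Longrightarrow> fm (a + 9 * N + 1) (\<lambda>x. walk M (M - int N) (f x) i = c)"
proof (induction N arbitrary: i c)
  case 0
  have "walk M M (f x) i = M" for x
    using walk_bounds[OF M_nonneg, of M "f x" i] by simp
  then show ?case by (simp add: fm_const)
next
  case (Suc N)
  define l where "l = M - int (Suc N)"
  have l: "l + 1 = M - int N" "l < M" "- M \<le> l" using Suc.prems by (auto simp: l_def)
  let ?d = "a + 9 * N + 1"
  let ?w = "\<lambda>x j. walk M (l + 1) (f x) j + f x j"
  have oh: "onehot ?d (\<lambda>x. walk M (l + 1) (f x) j)" if "j \<le> m" for j
  proof -
    have "\<bar>walk M (l + 1) (f x) j\<bar> \<le> M" for x
      using walk_bounds[OF M_nonneg, of "l + 1" "f x" j] l by auto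
    then show ?thesis using Suc.IH[OF _ that] Suc.prems l(1) by (simp add: onehot_def)
  qed
  have w: "fm (?d + 2) (\<lambda>x. P (?w x j))" if "j < m" for j P
    using that fm_pred2[OF oh[of j] onehot_mono[OF ks[of j]], of "\<lambda>u v. P (u + v)"] by simp
  have w': "fm (Suc (?d + 2)) (\<lambda>x. ?w x j \<le> l)" "fm (Suc (?d + 2)) (\<lambda>x. ?w x j \<le> M)" if "j < m" for j
    by (rule formula_mono[OF w[OF that]], simp)+
  let ?\<delta> = "\<lambda>x. (\<exists>j\<in>{..<i}. ?w x j \<le> l \<and> (\<forall>k\<in>{j<..<i}. ?w x k \<le> M)) \<or> 0 \<le> l \<and> (\<forall>k\<in>{..<i}. ?w x k \<le> M)"
  have "fm (Suc (Suc (Suc (Suc (?d + 2))))) ?\<delta>"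
    using Suc.prems(2) m
    by (intro fm_disj fm_bex fm_conj fm_ball fm_const w w') auto
  moreover have "Suc (Suc (Suc (Suc (?d + 2)))) = ?d + 6" by simp
  ultimately have \<delta>: "fm (?d + 6) ?\<delta>" by (simp only:)
  have v: "fm a' (\<lambda>x. walk M (l + 1) (f x) i = c)" if "?d \<le> a'" for c a'
    using Suc.IH[OF _ Suc.prems(2), of c] Suc.prems(1) that l(1) by (auto intro: formula_mono)
  have "fm (Suc (Suc (Suc (?d + 6)))) (\<lambda>x. ?\<delta> x \<and> walk M (l + 1) (f x) i = c + 1 \<or> \<not> ?\<delta> x \<and> walk M (l + 1) (f x) i = c)"
    by (intro fm_disj fm_conj fm_not \<delta> formula_mono[OF \<delta>] v) auto
  moreover have "(walk M l (f x) i = c) = (?\<delta> x \<and> walk M (l + 1) (f x) i = c + 1 \<or> \<not> ?\<delta> x \<and> walk M (l + 1) (f x) i = c)" for x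
    using walk_barrier_step[OF M_nonneg l(2), of "f x" i] by (cases "?\<delta> x") auto
  moreover have "Suc (Suc (Suc (?d + 6))) = a + 9 * Suc N + 1" by simp
  ultimately show ?case unfolding l_def[symmetric] by simp
qed

text \<open>The barrier travels \<open>2 * M\<close> units from \<open>M\<close> to
  \<open>- M\<close>. The depth grows with \<open>M\<close>, so it is constant only for constant
  precision.\<close>

lemma onehot_clamped_sum:
  assumes ks: "\<forall>k\<in>set ks. onehot a k" and len: "length ks < K"
  shows "onehot (a + 9 * nat (2 * M) + 1) (\<lambda>x. foldl (clamp_add (- M) M) 0 (map (\<lambda>k. k x) ks))"
proof -
  let ?f = "\<lambda>x i. (ks ! i) x"
  have "map (\<lambda>k. k x) ks = map (?f x) [0..<length ks]" for x
    by (rule nth_equalityI) auto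
  then have eq: "foldl (clamp_add (- M) M) 0 (map (\<lambda>k. k x) ks) = walk M (- M) (?f x) (length ks)" for x
    using M_nonneg by (simp add: walk_def)
  have "fm (a + 9 * nat (2 * M) + 1) (\<lambda>x. walk M (M - int (nat (2 * M))) (?f x) (length ks) = c)" for c
    using ks len M_nonneg by (intro fm_walk[where m = "length ks"]) auto
  moreover have "M - int (nat (2 * M)) = - M" using M_nonneg by simp
  moreover have "\<bar>walk M (- M) (?f x) (length ks)\<bar> \<le> M" for x
    using walk_bounds[OF M_nonneg, of "- M" "?f x" "length ks"] M_nonneg by auto
  ultimately show ?thesis unfolding onehot_def eq by simp
qed

end

section \<open>Transformer layers as formulas\<close>

lemma fsum_of_int:
  "fsum p (map (\<lambda>k. of_int k / 2 ^ p) ks) = of_int (foldl (clamp_add (- maxk p) (maxk p)) 0 ks) / 2 ^ p"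
proof (induction ks rule: rev_induct)
  case (snoc k ks)
  have "fadd p (of_int i / 2 ^ p) (of_int k / 2 ^ p) = of_int (clamp_add (- maxk p) (maxk p) i k) / 2 ^ p" for i
    unfolding fadd_def clamp_add_def rd_of_int[symmetric] by (simp add: add_divide_distrib)
  with snoc show ?case by (simp add: fsum_def)
qed (simp add: fsum_def)

text \<open>Here \<open>A\<close> is the depth cost of a rounded sum of up to \<open>W\<close>
  terms. The translation of layers is done once over this interface, which both constructions of
  sums implement.\<close>

locale tf_formulas = formula_calculus b n K Fs "maxk p" for b n K Fs p +
  fixes A W :: nat
  assumes onehot_sum: "\<forall>k\<in>set ks. onehot a k \<Longrightarrow> length ks \<le> W \<Longrightarrow>
    onehot (a + A) (\<lambda>x. foldl (clamp_add (- maxk p) (maxk p)) 0 (map (\<lambda>k. k x) ks))"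
begin

definition rep :: "nat \<Rightarrow> (bool list \<Rightarrow> real) \<Rightarrow> bool" where
  "rep a v \<longleftrightarrow> (\<exists>k. onehot a k \<and> (\<forall>x. length x = n \<longrightarrow> v x = of_int (k x) / 2 ^ p))"

definition lrep :: "nat \<Rightarrow> nat \<Rightarrow> (bool list \<Rightarrow> real list) \<Rightarrow> bool" where
  "lrep a m U \<longleftrightarrow> (\<forall>x. length x = n \<longrightarrow> length (U x) = m) \<and> (\<forall>j<m. rep a (\<lambda>x. U x ! j))"

definition mrep :: "nat \<Rightarrow> nat \<Rightarrow> nat \<Rightarrow> (bool list \<Rightarrow> real list list) \<Rightarrow> bool" where
  "mrep a r m Z \<longleftrightarrow> (\<forall>x. length x = n \<longrightarrow> length (Z x) = r) \<and> (\<forall>i<r. lrep a m (\<lambda>x. Z x ! i))"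

lemma rep_mono: "rep a v \<Longrightarrow> a \<le> a' \<Longrightarrow> rep a' v"
  by (auto simp: rep_def intro: onehot_mono)

lemma lrep_mono: "lrep a m U \<Longrightarrow> a \<le> a' \<Longrightarrow> lrep a' m U"
  by (auto simp: lrep_def intro: rep_mono)

lemma rep_cong: "(\<And>x. length x = n \<Longrightarrow> v x = w x) \<Longrightarrow> rep a v \<longleftrightarrow> rep a w"
  by (simp add: rep_def)

lemma lrep_cong: "(\<And>x. length x = n \<Longrightarrow> U x = V x) \<Longrightarrow> lrep a m U \<longleftrightarrow> lrep a m V"
  by (simp add: lrep_def rep_def)

lemma rep_fx: "rep a v \<Longrightarrow> length x = n \<Longrightarrow> v x \<in> fx p"
  by (auto simp: rep_def onehot_def fx_iff)

lemma rep_fm: "rep a v \<Longrightarrow> \<bar>c\<bar> \<le> maxk p \<Longrightarrow> fm a (\<lambda>x. v x = of_int c / 2 ^ p)"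
proof -
  assume "rep a v" and c: "\<bar>c\<bar> \<le> maxk p"
  then obtain k where k: "onehot a k" "\<And>x. length x = n \<Longrightarrow> v x = of_int (k x) / 2 ^ p"
    unfolding rep_def by blast
  then have "fm a (\<lambda>x. k x = c)" using c by (simp add: onehot_def)
  then show ?thesis by (rule formula_cong[THEN iffD1, rotated]) (simp add: k(2))
qed

lemma rep_const: "c \<in> fx p \<Longrightarrow> rep (Suc a) (\<lambda>x. c)"
  unfolding rep_def fx_iff using onehot_const[of _ a] by blast

text \<open>The operation is tabulated, so all that matters is that it maps \<open>fx p\<close> to
  itself. Exponentials and quotients after rounding cost no more than products.\<close>

lemma rep_op2:
  assumes "rep a v" "rep a w" and op: "\<And>s t. s \<in> fx p \<Longrightarrow> t \<in> fx p \<Longrightarrow> f s t \<in> fx p"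
  shows "rep (a + 2) (\<lambda>x. f (v x) (w x))"
proof -
  obtain k l where k: "onehot a k" "\<And>x. length x = n \<Longrightarrow> v x = of_int (k x) / 2 ^ p"
    and l: "onehot a l" "\<And>x. length x = n \<Longrightarrow> w x = of_int (l x) / 2 ^ p"
    using assms(1,2) unfolding rep_def by metis
  \<comment> \<open>Results of \<open>f\<close> are multiples of \<open>1 / 2 ^ p\<close>, so the
    floor just reads off the numerator.\<close>
  define g where "g i j = \<lfloor>f (of_int i / 2 ^ p) (of_int j / 2 ^ p) * 2 ^ p\<rfloor>" for i j
  have g: "\<bar>g i j\<bar> \<le> maxk p \<and> f (of_int i / 2 ^ p) (of_int j / 2 ^ p) = of_int (g i j) / 2 ^ p"
    if "\<bar>i\<bar> \<le> maxk p" "\<bar>j\<bar> \<le> maxk p" for i j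
  proof -
    have "f (of_int i / 2 ^ p) (of_int j / 2 ^ p) \<in> fx p"
      using that by (intro op) (auto simp: fx_iff)
    then obtain c where c: "\<bar>c\<bar> \<le> maxk p" "f (of_int i / 2 ^ p) (of_int j / 2 ^ p) = of_int c / 2 ^ p"
      unfolding fx_iff by blast
    then have "g i j = c" by (simp add: g_def)
    with c show ?thesis by simp
  qed
  have "onehot (a + 2) (\<lambda>x. g (k x) (l x))"
    using g by (intro onehot_op2 k(1) l(1)) auto
  moreover have "f (v x) (w x) = of_int (g (k x) (l x)) / 2 ^ p" if "length x = n" for x
    unfolding k(2)[OF that] l(2)[OF that] using k(1) l(1) that by (intro g[THEN conjunct2]) (auto simp: onehot_def)
  ultimately show ?thesis unfolding rep_def by blast
qed

lemma rep_op1: "rep a v \<Longrightarrow> (\<And>s. s \<in> fx p \<Longrightarrow> f s \<in> fx p) \<Longrightarrow> rep (a + 2) (\<lambda>x. f (v x))"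
  by (rule rep_op2[where f = "\<lambda>s t. f s"]) auto

lemma rep_fsum:
  assumes U: "lrep a m U" and m: "m \<le> W"
  shows "rep (a + A) (\<lambda>x. fsum p (U x))"
proof -
  have "\<forall>j\<in>{..<m}. \<exists>k. onehot a k \<and> (\<forall>x. length x = n \<longrightarrow> U x ! j = of_int (k x) / 2 ^ p)"
    using U unfolding lrep_def rep_def by blast
  then obtain k where k: "\<And>j. j < m \<Longrightarrow> onehot a (k j)"
    "\<And>j x. j < m \<Longrightarrow> length x = n \<Longrightarrow> U x ! j = of_int (k j x) / 2 ^ p"
    by (metis lessThan_iff)
  define ks where "ks = map k [0..<m]"
  have "onehot (a + A) (\<lambda>x. foldl (clamp_add (- maxk p) (maxk p)) 0 (map (\<lambda>k. k x) ks))"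
    using k(1) m by (intro onehot_sum) (auto simp: ks_def)
  moreover have "fsum p (U x) = of_int (foldl (clamp_add (- maxk p) (maxk p)) 0 (map (\<lambda>k. k x) ks)) / 2 ^ p"
    if "length x = n" for x
  proof -
    have "U x = map (\<lambda>k. of_int k / 2 ^ p) (map (\<lambda>k. k x) ks)"
      using U that k(2) by (intro nth_equalityI) (auto simp: lrep_def ks_def)
    then show ?thesis by (simp only: fsum_of_int)
  qed
  ultimately show ?thesis unfolding rep_def by blast
qed

lemma lrep_map2:
  assumes "lrep a m U" "lrep a m V" "\<And>s t. s \<in> fx p \<Longrightarrow> t \<in> fx p \<Longrightarrow> f s t \<in> fx p"
  shows "lrep (a + 2) m (\<lambda>x. map2 f (U x) (V x))"
  unfolding lrep_def
proof (intro conjI allI impI)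
  fix j assume "j < m"
  then have "rep (a + 2) (\<lambda>x. f (U x ! j) (V x ! j))"
    using assms by (intro rep_op2) (auto simp: lrep_def)
  then show "rep (a + 2) (\<lambda>x. map2 f (U x) (V x) ! j)"
    by (rule rep_cong[THEN iffD1, rotated]) (use assms \<open>j < m\<close> in \<open>simp add: lrep_def\<close>)
qed (use assms in \<open>simp add: lrep_def\<close>)

lemma lrep_map:
  assumes "lrep a m U" "\<And>s. s \<in> fx p \<Longrightarrow> f s \<in> fx p"
  shows "lrep (a + 2) m (\<lambda>x. map f (U x))"
  unfolding lrep_def
proof (intro conjI allI impI)
  fix j assume "j < m"
  then have "rep (a + 2) (\<lambda>x. f (U x ! j))"
    using assms by (intro rep_op1) (auto simp: lrep_def)
  then show "rep (a + 2) (\<lambda>x. map f (U x) ! j)"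
    by (rule rep_cong[THEN iffD1, rotated]) (use assms \<open>j < m\<close> in \<open>simp add: lrep_def\<close>)
qed (use assms in \<open>simp add: lrep_def\<close>)

lemma rep_fdot: "lrep a m U \<Longrightarrow> lrep a m V \<Longrightarrow> m \<le> W \<Longrightarrow> rep (a + 2 + A) (\<lambda>x. fdot p (U x) (V x))"
  unfolding fdot_def by (intro rep_fsum[of _ m] lrep_map2) auto

lemma lrep_const: "vec_ok p m v \<Longrightarrow> lrep (Suc a) m (\<lambda>x. v)"
  by (auto simp: lrep_def vec_ok_def intro!: rep_const)

lemma lrep_fmv:
  assumes "mat_ok p r m X" "lrep (Suc a) m U" "m \<le> W"
  shows "lrep (Suc a + 2 + A) r (\<lambda>x. fmv p X (U x))"
  unfolding lrep_def
proof (intro conjI allI impI)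
  fix j assume "j < r"
  then have "vec_ok p m (X ! j)" using assms(1) by (simp add: mat_ok_def)
  then have "rep (Suc a + 2 + A) (\<lambda>x. fdot p (X ! j) (U x))"
    by (intro rep_fdot[of _ m] lrep_const assms)
  then show "rep (Suc a + 2 + A) (\<lambda>x. fmv p X (U x) ! j)"
    using assms(1) \<open>j < r\<close> by (simp add: mat_ok_def nth_fmv)
qed (use assms in \<open>simp add: mat_ok_def\<close>)

lemma lrep_fvadd: "lrep a m U \<Longrightarrow> lrep a m V \<Longrightarrow> lrep (a + 2) m (\<lambda>x. fvadd p (U x) (V x))"
  unfolding fvadd_def by (intro lrep_map2) auto

lemma lrep_fvsum:
  assumes Z: "mrep a r d Z" and r: "r \<le> W"
  shows "lrep (a + A) d (\<lambda>x. fvsum p d (Z x))"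
  unfolding lrep_def
proof (intro conjI allI impI)
  have len: "length v = d" if "length x = n" "v \<in> set (Z x)" for x v
    using Z that by (auto simp: mrep_def lrep_def in_set_conv_nth)
  then show "length (fvsum p d (Z x)) = d" if "length x = n" for x
    using that by (intro length_fvsum)
  fix j assume "j < d"
  then have "lrep a r (\<lambda>x. map (\<lambda>v. v ! j) (Z x))"
    unfolding lrep_def
  proof (intro conjI allI impI)
    fix i assume "i < r"
    then have "rep a (\<lambda>x. Z x ! i ! j)" using Z \<open>j < d\<close> by (auto simp: mrep_def lrep_def)
    then show "rep a (\<lambda>x. map (\<lambda>v. v ! j) (Z x) ! i)"
      by (rule rep_cong[THEN iffD1, rotated]) (use Z \<open>i < r\<close> in \<open>simp add: mrep_def\<close>)
  qed (use Z in \<open>simp add: mrep_def\<close>)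
  then have "rep (a + A) (\<lambda>x. fsum p (map (\<lambda>v. v ! j) (Z x)))" using r by (rule rep_fsum)
  then show "rep (a + A) (\<lambda>x. fvsum p d (Z x) ! j)"
    by (rule rep_cong[THEN iffD1, rotated]) (use len \<open>j < d\<close> in \<open>simp add: nth_fvsum\<close>)
qed

text \<open>Four sums on a path (projection, score, normalizer, weighted values) give
  \<open>4 * A\<close>. Two levels each for the products of projection and score, the exponential,
  the quotient and the weighting give 10. The depth starts at \<open>Suc a\<close> because constants
  need one level.\<close>

lemma lrep_head_out:
  assumes Z: "mrep (Suc a) n d Z" and h: "head_ok p d h" and W: "d \<le> W" "n \<le> W" and i: "i < n"
  shows "lrep (Suc a + 10 + 4 * A) d (\<lambda>x. head_out p h (Z x) i)"
proof -
  obtain dh where dh: "dh \<le> d" "mat_ok p dh d (hQ h)" "mat_ok p dh d (hK h)" "mat_ok p d d (hV h)"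
    using h by (auto simp: head_ok_def)
  have row: "lrep (Suc a) d (\<lambda>x. Z x ! j)" if "j < n" for j using Z that by (simp add: mrep_def)
  have lenZ: "length (Z x) = n" if "length x = n" for x using Z that by (simp add: mrep_def)
  define es where "es x = map (\<lambda>zj. rd p (exp (fdot p (fmv p (hQ h) (Z x ! i)) (fmv p (hK h) zj)))) (Z x)" for x
  define ws where "ws x = map (\<lambda>e. rd p (e / fsum p (es x))) (es x)" for x
  have es: "lrep (Suc a + 6 + 2 * A) n es"
    unfolding lrep_def
  proof (intro conjI allI impI)
    fix j assume j: "j < n"
    have "rep (Suc a + 2 + A + 2 + A + 2)
        (\<lambda>x. rd p (exp (fdot p (fmv p (hQ h) (Z x ! i)) (fmv p (hK h) (Z x ! j)))))"
      using dh W by (intro rep_op1 rep_fdot[of _ dh] lrep_fmv[of _ d] row i j) auto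
    then have "rep (Suc a + 6 + 2 * A)
        (\<lambda>x. rd p (exp (fdot p (fmv p (hQ h) (Z x ! i)) (fmv p (hK h) (Z x ! j)))))"
      by (rule rep_mono) simp
    then show "rep (Suc a + 6 + 2 * A) (\<lambda>x. es x ! j)"
      by (rule rep_cong[THEN iffD1, rotated]) (simp add: es_def lenZ j)
  qed (simp add: es_def lenZ)
  have ws: "rep (Suc a + 8 + 3 * A) (\<lambda>x. ws x ! j)" if "j < n" for j
  proof -
    have "rep (Suc a + 6 + 2 * A + A + 2) (\<lambda>x. rd p (es x ! j / fsum p (es x)))"
    proof (rule rep_op2[where f = "\<lambda>s t. rd p (s / t)"])
      show "rep (Suc a + 6 + 2 * A + A) (\<lambda>x. es x ! j)"
        by (rule rep_mono[of "Suc a + 6 + 2 * A"]) (use es that in \<open>auto simp: lrep_def\<close>)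
      show "rep (Suc a + 6 + 2 * A + A) (\<lambda>x. fsum p (es x))"
        by (rule rep_fsum[OF es W(2)])
    qed simp
    then have "rep (Suc a + 8 + 3 * A) (\<lambda>x. rd p (es x ! j / fsum p (es x)))"
      by (rule rep_mono) simp
    then show ?thesis
      by (rule rep_cong[THEN iffD1, rotated]) (use es that in \<open>simp add: ws_def lrep_def\<close>)
  qed
  have lenws: "length (ws x) = n" if "length x = n" for x
    using that by (simp add: ws_def es_def lenZ)
  let ?Y = "\<lambda>x. map2 (\<lambda>w zj. map (fmul p w) (fmv p (hV h) zj)) (ws x) (Z x)"
  have "mrep (Suc a + 10 + 3 * A) n d ?Y"
    unfolding mrep_def
  proof (intro conjI allI impI)
    fix j assume j: "j < n"
    have "lrep (Suc a + 2 + A) d (\<lambda>x. fmv p (hV h) (Z x ! j))"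
      using dh W by (intro lrep_fmv[of _ d] row j) auto
    then have V: "lrep (Suc a + 8 + 3 * A) d (\<lambda>x. fmv p (hV h) (Z x ! j))" by (rule lrep_mono) simp
    show "lrep (Suc a + 10 + 3 * A) d (\<lambda>x. ?Y x ! j)"
      unfolding lrep_def
    proof (intro conjI allI impI)
      fix r assume r: "r < d"
      have "rep (Suc a + 8 + 3 * A + 2) (\<lambda>x. fmul p (ws x ! j) (fmv p (hV h) (Z x ! j) ! r))"
        using V r by (intro rep_op2 ws j) (auto simp: lrep_def)
      then have "rep (Suc a + 10 + 3 * A) (\<lambda>x. fmul p (ws x ! j) (fmv p (hV h) (Z x ! j) ! r))"
        by (rule rep_mono) simp
      then show "rep (Suc a + 10 + 3 * A) (\<lambda>x. ?Y x ! j ! r)"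
        by (rule rep_cong[THEN iffD1, rotated]) (use dh(4) j r in \<open>simp add: lenws lenZ mat_ok_def\<close>)
    qed (use dh(4) j in \<open>simp add: lenws lenZ mat_ok_def\<close>)
  qed (simp add: lenws lenZ)
  then have "lrep (Suc a + 10 + 3 * A + A) d (\<lambda>x. fvsum p d (?Y x))"
    using W by (intro lrep_fvsum)
  then have "lrep (Suc a + 10 + 4 * A) d (\<lambda>x. fvsum p d (?Y x))" by (rule lrep_mono) simp
  moreover have "fvsum p d (?Y x) = head_out p h (Z x) i" if "length x = n" for x
    using row[OF i] that unfolding head_out_def Let_def ws_def es_def by (simp add: lrep_def)
  ultimately show ?thesis by (rule lrep_cong[THEN iffD1, rotated])
qed

text \<open>To the \<open>10 + 4 * A\<close> of a head come the sum over heads and the two matrix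
  products, \<open>3 * A\<close> in all, and two levels each for two residual additions, two sets of
  products, bias and ReLU.\<close>

lemma mrep_layer_apply:
  assumes Z: "mrep (Suc a) n d Z" and L: "layer_ok p d L" and W: "d \<le> W" "n \<le> W" "length (heads L) \<le> W"
  shows "mrep (Suc a + 22 + 7 * A) n d (\<lambda>x. layer_apply p L (Z x))"
proof -
  obtain m where m: "m \<le> d" "mat_ok p m d (W1 L)" "vec_ok p m (b1 L)" "mat_ok p d m (W2 L)"
    and hd: "\<And>h. h \<in> set (heads L) \<Longrightarrow> head_ok p d h"
    using L by (auto simp: layer_ok_def)
  have row: "lrep (Suc a) d (\<lambda>x. Z x ! j)" if "j < n" for j using Z that by (simp add: mrep_def)
  have lenZ: "length (Z x) = n" if "length x = n" for x using Z that by (simp add: mrep_def)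
  let ?y = "\<lambda>i x. fvadd p (Z x ! i) (fvsum p d (map (\<lambda>h. head_out p h (Z x) i) (heads L)))"
  let ?o = "\<lambda>i x. fvadd p (?y i x) (fmv p (W2 L) (map (max 0) (fvadd p (fmv p (W1 L) (?y i x)) (b1 L))))"
  have o: "lrep (Suc a + 22 + 7 * A) d (?o i)" if i: "i < n" for i
  proof -
    have "mrep (Suc a + 10 + 4 * A) (length (heads L)) d (\<lambda>x. map (\<lambda>h. head_out p h (Z x) i) (heads L))"
      unfolding mrep_def using lrep_head_out[OF Z hd[OF nth_mem] W(1,2) i] by simp
    then have hs: "lrep (Suc a + 10 + 4 * A + A) d (\<lambda>x. fvsum p d (map (\<lambda>h. head_out p h (Z x) i) (heads L)))"
      using W by (intro lrep_fvsum)
    have y: "lrep (Suc (a + 10 + 4 * A + A + 2)) d (?y i)"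
      using lrep_fvadd[OF lrep_mono[OF row[OF i], of "Suc a + 10 + 4 * A + A"] hs] by simp
    have ff: "lrep (Suc (a + 10 + 4 * A + A + 2 + 2 + A + 2 + 2) + 2 + A) d
       (\<lambda>x. fmv p (W2 L) (map (max 0) (fvadd p (fmv p (W1 L) (?y i x)) (b1 L))))"
    proof (rule lrep_fmv[OF m(4)])
      have 1: "lrep (Suc (a + 10 + 4 * A + A + 2) + 2 + A) m (\<lambda>x. fmv p (W1 L) (?y i x))"
        using lrep_fmv[OF m(2) y W(1)] .
      have 2: "lrep (Suc (a + 10 + 4 * A + A + 2) + 2 + A) m (\<lambda>x. b1 L)"
        by (rule lrep_mono[OF lrep_const[OF m(3), of 0]]) simp
      have "lrep (Suc (a + 10 + 4 * A + A + 2) + 2 + A + 2 + 2) m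
          (\<lambda>x. map (max 0) (fvadd p (fmv p (W1 L) (?y i x)) (b1 L)))"
        by (rule lrep_map[OF lrep_fvadd[OF 1 2]]) (auto simp: max_def)
      then show "lrep (Suc (a + 10 + 4 * A + A + 2 + 2 + A + 2 + 2)) m
          (\<lambda>x. map (max 0) (fvadd p (fmv p (W1 L) (?y i x)) (b1 L)))" by simp
    qed (use m W in simp)
    have "lrep (Suc (a + 10 + 4 * A + A + 2 + 2 + A + 2 + 2) + 2 + A + 2) d (?o i)"
      by (rule lrep_fvadd[OF lrep_mono[OF y] ff]) simp
    then show ?thesis by (rule lrep_mono) simp
  qed
  have lenr: "length (Z x ! i) = d" if "length x = n" "i < n" for x i
    using row[OF that(2)] that(1) by (simp add: lrep_def)
  have "layer_apply p L (Z x) = map (\<lambda>i. ?o i x) [0..<n]" if "length x = n" for x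
    using that unfolding layer_apply_def Let_def by (simp add: lenZ lenr)
  with o show ?thesis by (simp add: mrep_def lrep_def rep_def)
qed

lemma fm_rep_less:
  assumes "rep a v" "rep a w"
  shows "fm (a + 2) (\<lambda>x. v x < w x)"
proof -
  obtain k l where k: "onehot a k" "\<And>x. length x = n \<Longrightarrow> v x = of_int (k x) / 2 ^ p"
    and l: "onehot a l" "\<And>x. length x = n \<Longrightarrow> w x = of_int (l x) / 2 ^ p"
    using assms(1,2) unfolding rep_def by metis
  have "fm (a + 2) (\<lambda>x. real_of_int (k x) / 2 ^ p < of_int (l x) / 2 ^ p)"
    by (rule fm_pred2[OF k(1) l(1)])
  then show ?thesis by (rule formula_cong[THEN iffD1, rotated]) (simp add: k(2) l(2))
qed

end

section \<open>Loops as stages of formulas\<close>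

definition stage :: "nat \<Rightarrow> nat \<Rightarrow> nat \<Rightarrow> (bool list \<Rightarrow> real list list) \<Rightarrow> (bool list \<Rightarrow> bool) list" where
  "stage p n d Z = map (\<lambda>(i, j, k) x. Z x ! i ! j = of_int k / 2 ^ p)
     (List.product [0..<n] (List.product [0..<d] [- maxk p..maxk p]))"

lemma length_stage: "length (stage p n d Z) \<le> n * (d * (2 * 4 ^ p))"
proof -
  have "nat (2 * maxk p + 1) \<le> 2 * 4 ^ p"
    unfolding maxk_def by (simp add: power_mult nat_le_iff)
  then show ?thesis by (simp add: stage_def add.commute[of 1])
qed

definition state_ok :: "nat \<Rightarrow> nat \<Rightarrow> nat \<Rightarrow> (bool list \<Rightarrow> real list list) \<Rightarrow> bool" where
  "state_ok p n d Z \<longleftrightarrow> (\<forall>x. length x = n \<longrightarrow> length (Z x) = n \<and>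
     (\<forall>i<n. length (Z x ! i) = d \<and> (\<forall>j<d. Z x ! i ! j \<in> fx p)))"

context tf_formulas
begin

lemma fm_stage: "mrep a n d Z \<Longrightarrow> f \<in> set (stage p n d Z) \<Longrightarrow> fm a f"
  by (auto simp: stage_def mrep_def lrep_def intro!: rep_fm)

lemma state_ok_mrep: "mrep a n d Z \<Longrightarrow> state_ok p n d Z"
  unfolding state_ok_def mrep_def lrep_def using rep_fx by blast

text \<open>Once the one-hot bits of a state are base functions they count as depth 0. This resets
  the depth at every layer.\<close>

lemma mrep_stage:
  assumes Z: "state_ok p n d Z" and Fs: "set (stage p n d Z) \<subseteq> Fs"
  shows "mrep a n d Z"
proof -
  have "rep a (\<lambda>x. Z x ! i ! j)" if ij: "i < n" "j < d" for i j
    unfolding rep_def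
  proof (intro exI conjI allI impI)
    have fx: "\<exists>k. \<bar>k\<bar> \<le> maxk p \<and> Z x ! i ! j = of_int k / 2 ^ p" if "length x = n" for x
      using Z ij that by (auto simp: state_ok_def fx_iff)
    show "Z x ! i ! j = of_int \<lfloor>Z x ! i ! j * 2 ^ p\<rfloor> / 2 ^ p" if "length x = n" for x
      using fx[OF that] by auto
    show "onehot a (\<lambda>x. \<lfloor>Z x ! i ! j * 2 ^ p\<rfloor>)"
      unfolding onehot_def
    proof (intro conjI allI impI)
      show "\<bar>\<lfloor>Z x ! i ! j * 2 ^ p\<rfloor>\<bar> \<le> maxk p" if "length x = n" for x
        using fx[OF that] by auto
      fix c assume c: "\<bar>c\<bar> \<le> maxk p"
      have "(i, j, c) \<in> set (List.product [0..<n] (List.product [0..<d] [- maxk p..maxk p]))"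
        using ij c by auto
      then have "(\<lambda>x. Z x ! i ! j = of_int c / 2 ^ p) \<in> set (stage p n d Z)"
        unfolding stage_def set_map by (rule image_eqI[rotated]) simp
      then show "fm a (\<lambda>x. \<lfloor>Z x ! i ! j * 2 ^ p\<rfloor> = c)"
        using Fs by (intro formula.base[of "\<lambda>x. Z x ! i ! j = of_int c / 2 ^ p"]) (use fx in fastforce)+
    qed
  qed
  then show ?thesis using Z by (simp add: mrep_def lrep_def state_ok_def)
qed

text \<open>The embedding is position-wise, so each coordinate takes two values, selected by one
  input bit.\<close>

lemma mrep_embedding:
  assumes "\<And>i. i < n \<Longrightarrow> (\<lambda>x. x ! i) \<in> Fs" "\<And>i b. i < n \<Longrightarrow> vec_ok p d (e i b)"
  shows "mrep 3 n d (\<lambda>x. map (\<lambda>i. e i (x ! i)) [0..<length x])"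
proof -
  have rep: "rep 3 (\<lambda>x. e i (x ! i) ! j)" if ij: "i < n" "j < d" for i j
  proof -
    have "e i b ! j \<in> fx p" for b
      using assms(2)[OF ij(1), of b] ij(2) by (auto simp: vec_ok_def)
    then have "\<forall>b. \<exists>k. \<bar>k\<bar> \<le> maxk p \<and> e i b ! j = of_int k / 2 ^ p" unfolding fx_iff by blast
    then obtain k where k: "\<And>b. \<bar>k b\<bar> \<le> maxk p" "\<And>b. e i b ! j = of_int (k b) / 2 ^ p" by metis
    have inp: "fm a (\<lambda>x. x ! i)" for a using assms(1)[OF ij(1)] by (rule formula.base) simp
    have "fm (Suc (Suc (Suc 0))) (\<lambda>x. x ! i \<and> k True = c \<or> \<not> x ! i \<and> k False = c)" for c
      by (intro fm_disj fm_conj fm_not fm_const inp)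
    moreover have "(x ! i \<and> k True = c \<or> \<not> x ! i \<and> k False = c) = (k (x ! i) = c)" for x c
      by (cases "x ! i") auto
    ultimately have "fm 3 (\<lambda>x. k (x ! i) = c)" for c by (simp add: numeral_3_eq_3)
    then have "onehot 3 (\<lambda>x. k (x ! i))" using k(1) by (simp add: onehot_def)
    then show ?thesis unfolding rep_def using k(2) by blast
  qed
  have "lrep 3 d (\<lambda>x. map (\<lambda>i. e i (x ! i)) [0..<length x] ! i)" if "i < n" for i
  proof -
    have "lrep 3 d (\<lambda>x. e i (x ! i))"
      using rep[OF that] assms(2)[OF that] by (simp add: lrep_def vec_ok_def)
    then show ?thesis by (rule lrep_cong[THEN iffD1, rotated]) (use that in simp)
  qed
  then show ?thesis by (simp add: mrep_def)
qed

end

lemma foldl_concat_replicate: "foldl f z (concat (replicate k xs)) = ((\<lambda>z. foldl f z xs) ^^ k) z"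
proof (induction k arbitrary: z)
  case (Suc k)
  then show ?case using funpow_swap1[of "\<lambda>z. foldl f z xs" k z] by simp
qed simp

text \<open>Unrolling gives \<open>T\<close> layers. Stage 0 holds the inputs, stage
  \<open>t + 1\<close> the state after \<open>t\<close> layers, and stage \<open>T + 2\<close> the
  output bit. The depth \<open>23 + 7 * A\<close> is that of a layer started at depth 1; embedding
  and output are shallower. \<open>tf\<close> ranges over all \<open>Fs\<close> because every stage
  has its own base functions.\<close>

lemma looped_tf_circuit:
  fixes Mo :: looped_tf
  defines "p \<equiv> prec Mo" and "d \<equiv> dim Mo" and "T \<equiv> iters Mo * length (blk Mo)"
  assumes n: "1 \<le> n" and ok: "lt_ok n Mo" and heads: "\<forall>La\<in>set (blk Mo). length (heads La) \<le> W"
    and W: "d \<le> W" "n \<le> W" and tf: "\<And>Fs. tf_formulas b n K Fs p A W"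
  shows "\<exists>C. circ_wf n C \<and> (\<forall>gw\<in>set C. b \<or> ac_gate (fst gw))
    \<and> circ_size C \<le> (T + 2) * ((n * (d * (2 * 4 ^ p)) + n + 1) * (K + 2) ^ (23 + 7 * A)) + 2
    \<and> circ_depth C \<le> (23 + 7 * A) * (T + 2) + 1
    \<and> (\<forall>x. length x = n \<longrightarrow> circ_out x C = lt_out Mo x)"
proof -
  define Ls where "Ls = concat (replicate (iters Mo) (blk Mo))"
  define Z where "Z t x = foldl (\<lambda>zs L. layer_apply p L zs) (map (\<lambda>i. emb Mo i (x ! i)) [0..<length x]) (take t Ls)" for t x
  have lenLs: "length Ls = T" by (simp add: Ls_def T_def length_concat sum_list_replicate)
  have Z_Suc: "Z (Suc t) x = layer_apply p (Ls ! t) (Z t x)" if "t < T" for t x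
    using that unfolding Z_def by (simp add: take_Suc_conv_app_nth lenLs)
  have L_ok: "layer_ok p d (Ls ! t)" "length (heads (Ls ! t)) \<le> W" if "t < T" for t
  proof -
    have "Ls ! t \<in> set (blk Mo)"
      using that nth_mem[of t Ls] lenLs by (auto simp: Ls_def split: if_splits)
    then show "layer_ok p d (Ls ! t)" "length (heads (Ls ! t)) \<le> W"
      using ok heads by (auto simp: lt_ok_def p_def d_def)
  qed
  define inputs where "inputs = map (\<lambda>i (x :: bool list). x ! i) [0..<n]"
  have mrep0: "tf_formulas.mrep b n K (set inputs) p 3 n d (Z 0)"
  proof -
    interpret tf_formulas b n K "set inputs" p A W by (rule tf)
    have "mrep 3 n d (\<lambda>x. map (\<lambda>i. emb Mo i (x ! i)) [0..<length x])"
      using ok by (intro mrep_embedding) (auto simp: inputs_def lt_ok_def p_def d_def)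
    then show ?thesis by (simp add: Z_def[abs_def])
  qed
  have mrepS: "tf_formulas.mrep b n K (set (stage p n d (Z t))) p (23 + 7 * A) n d (Z (Suc t))"
    if "state_ok p n d (Z t)" "t < T" for t
  proof -
    interpret tf_formulas b n K "set (stage p n d (Z t))" p A W by (rule tf)
    have "mrep (Suc 0) n d (Z t)" using that(1) by (intro mrep_stage) auto
    then have "mrep (Suc 0 + 22 + 7 * A) n d (\<lambda>x. layer_apply p (Ls ! t) (Z t x))"
      using L_ok[OF that(2)] W by (intro mrep_layer_apply)
    moreover have "(\<lambda>x. layer_apply p (Ls ! t) (Z t x)) = Z (Suc t)"
      using Z_Suc[OF that(2)] by auto
    ultimately show ?thesis by simp
  qed
  have st: "state_ok p n d (Z t)" if "t \<le> T" for t
    using that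
  proof (induction t)
    case 0
    show ?case by (rule tf_formulas.state_ok_mrep[OF tf mrep0])
  next
    case (Suc t)
    then show ?case by (intro tf_formulas.state_ok_mrep[OF tf mrepS]) auto
  qed
  define Gs where "Gs t = (case t of 0 \<Rightarrow> inputs | Suc t \<Rightarrow> if t \<le> T then stage p n d (Z t) else [lt_out Mo])" for t
  have "\<exists>C. circ_wf n C \<and> (\<forall>gw\<in>set C. b \<or> ac_gate (fst gw))
    \<and> circ_size C \<le> (T + 2) * ((n * (d * (2 * 4 ^ p)) + n + 1) * (K + 2) ^ (23 + 7 * A)) + 2
    \<and> circ_depth C \<le> (23 + 7 * A) * (T + 2) + 1
    \<and> (\<forall>x. length x = n \<longrightarrow> circ_out x C = lt_out Mo x)"
  proof (rule formula_stages_decide[where Gs = Gs])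
    show "\<forall>f\<in>set (Gs 0). \<exists>j<n. \<forall>x. length x = n \<longrightarrow> f x = x ! j"
      by (auto simp: Gs_def inputs_def)
    show "lt_out Mo \<in> set (Gs (T + 2))" by (simp add: Gs_def)
    show "length (Gs t) \<le> n * (d * (2 * 4 ^ p)) + n + 1" for t
      using length_stage[of p n d] by (auto simp: Gs_def inputs_def intro: le_SucI trans_le_add1 split: nat.split)
    fix t f assume t: "t < T + 2" and f: "f \<in> set (Gs (Suc t))"
    consider "t = 0" | t' where "t = Suc t'" "t' < T" | "t = Suc T" using t by (cases t) force+
    then show "formula b n K (set (Gs t)) (23 + 7 * A) f"
    proof cases
      case 1
      then have "formula b n K (set inputs) 3 f"
        using f tf_formulas.fm_stage[OF tf mrep0] by (simp add: Gs_def)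
      then show ?thesis using 1 by (auto simp: Gs_def intro: formula_mono)
    next
      case (2 t')
      then show ?thesis using f tf_formulas.fm_stage[OF tf mrepS[OF st]] by (simp add: Gs_def)
    next
      case 3
      interpret tf_formulas b n K "set (stage p n d (Z T))" p A W by (rule tf)
      have Z: "mrep (Suc 0) n d (Z T)" using st by (intro mrep_stage) auto
      then have row: "lrep (Suc 0) d (\<lambda>x. Z T x ! (n - 1))" using n by (simp add: mrep_def)
      have "vec_ok p d (wo0 Mo)" "vec_ok p d (wo1 Mo)" using ok by (auto simp: lt_ok_def p_def d_def)
      then have "fm (Suc 0 + 2 + A + 2) (\<lambda>x. fdot p (wo0 Mo) (Z T x ! (n - 1)) < fdot p (wo1 Mo) (Z T x ! (n - 1)))"
        using row W by (intro fm_rep_less rep_fdot[of _ d] lrep_const)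
      moreover have "lt_out Mo x = (fdot p (wo0 Mo) (Z T x ! (n - 1)) < fdot p (wo1 Mo) (Z T x ! (n - 1)))"
        if "length x = n" for x
      proof -
        have "length (Z T x) = n" using st[of T] that by (simp add: state_ok_def)
        then have "Z T x ! (n - 1) = last (Z T x)" using n by (subst last_conv_nth) auto
        moreover have "Z T x = (block_apply p (blk Mo) ^^ iters Mo) (map (\<lambda>i. emb Mo i (x ! i)) [0..<length x])"
          unfolding Z_def using lenLs by (simp add: Ls_def foldl_concat_replicate block_apply_def[abs_def])
        ultimately show ?thesis by (simp add: lt_out_def Let_def p_def)
      qed
      ultimately have "fm (Suc 0 + 2 + A + 2) (lt_out Mo)" by (simp cong: formula_cong)
      then have "fm (23 + 7 * A) (lt_out Mo)" by (rule formula_mono) simp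
      then show ?thesis using 3 f by (simp add: Gs_def)
    qed
  qed
  then show ?thesis .
qed

section \<open>Polynomial bounds and the theorem\<close>

lemma maxk_less: "2 * maxk p + 1 \<le> int (2 * 4 ^ p)"
  unfolding maxk_def by (simp add: power_mult)

text \<open>This square covers all demands on the fan-in: tables over pairs of values,
  \<open>W * (2 * maxk p)\<close> unary bits at a threshold gate, and quantifiers over the up to
  \<open>W + 1\<close> positions of a sum. It is polynomial whenever \<open>W\<close> and
  \<open>2 ^ p\<close> are.\<close>

lemma formula_calculus_maxk: "formula_calculus ((W + 2 * 4 ^ p + 1)\<^sup>2) (maxk p)"
proof
  show "0 \<le> maxk p" by simp
  have "1 \<le> (4::nat) ^ p" by simp
  then have "2 \<le> W + 2 * 4 ^ p + 1" by linarith
  then have "2 * 1 \<le> (W + 2 * 4 ^ p + 1) * (W + 2 * 4 ^ p + 1)" by (intro mult_mono) auto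
  then show "2 \<le> (W + 2 * 4 ^ p + 1)\<^sup>2" by (simp add: power2_eq_square)
  have "(2 * maxk p + 1)\<^sup>2 \<le> (int (W + 2 * 4 ^ p + 1))\<^sup>2"
    using maxk_less[of p] maxk_nonneg[of p] by (intro power_mono) auto
  then show "(2 * maxk p + 1)\<^sup>2 \<le> int ((W + 2 * 4 ^ p + 1)\<^sup>2)" by simp
qed

lemma width_bounds:
  "W < (W + 2 * 4 ^ p + 1)\<^sup>2" "int W * (2 * maxk p) \<le> int ((W + 2 * 4 ^ p + 1)\<^sup>2)"
proof -
  have "W + 1 \<le> (W + 2 * 4 ^ p + 1) * 1" by simp
  also have "\<dots> \<le> (W + 2 * 4 ^ p + 1)\<^sup>2" unfolding power2_eq_square by (intro mult_left_mono) auto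
  finally show "W < (W + 2 * 4 ^ p + 1)\<^sup>2" by simp
  have "int W * (2 * maxk p) \<le> int (W + 2 * 4 ^ p + 1) * int (W + 2 * 4 ^ p + 1)"
    using maxk_less[of p] maxk_nonneg[of p] by (intro mult_mono) auto
  then show "int W * (2 * maxk p) \<le> int ((W + 2 * 4 ^ p + 1)\<^sup>2)"
    by (simp only: power2_eq_square of_nat_mult)
qed

lemma tf_formulas_threshold: "tf_formulas True n ((W + 2 * 4 ^ p + 1)\<^sup>2) Fs p 7 W"
proof -
  interpret formula_calculus True n "(W + 2 * 4 ^ p + 1)\<^sup>2" Fs "maxk p" by (rule formula_calculus_maxk)
  show ?thesis
  proof
    fix a and ks :: "(bool list \<Rightarrow> int) list"
    assume ks: "\<forall>k\<in>set ks. onehot a k" and len: "length ks \<le> W"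
    have "int (length ks) * (2 * maxk p) \<le> int W * (2 * maxk p)"
      using len by (intro mult_right_mono) auto
    also note width_bounds(2)
    finally show "onehot (a + 7) (\<lambda>x. foldl (clamp_add (- maxk p) (maxk p)) 0 (map (\<lambda>k. k x) ks))"
      using len width_bounds(1)[of W p] by (intro onehot_clamped_sum_threshold[OF TrueI ks]) linarith+
  qed
qed

text \<open>\<open>18 * 4 ^ q\<close> bounds \<open>9 * (2 * maxk p)\<close>. The bound
  \<open>q\<close> takes the place of \<open>p\<close> so that one depth serves all
  \<open>n\<close>.\<close>

lemma tf_formulas_unbounded_fanin:
  assumes "p \<le> q"
  shows "tf_formulas b n ((W + 2 * 4 ^ p + 1)\<^sup>2) Fs p (18 * 4 ^ q + 1) W"
proof -
  interpret formula_calculus b n "(W + 2 * 4 ^ p + 1)\<^sup>2" Fs "maxk p" by (rule formula_calculus_maxk)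
  show ?thesis
  proof
    fix a and ks :: "(bool list \<Rightarrow> int) list"
    assume ks: "\<forall>k\<in>set ks. onehot a k" and len: "length ks \<le> W"
    have "onehot (a + 9 * nat (2 * maxk p) + 1) (\<lambda>x. foldl (clamp_add (- maxk p) (maxk p)) 0 (map (\<lambda>k. k x) ks))"
      using len width_bounds(1)[of W p] by (intro onehot_clamped_sum[OF ks]) linarith
    moreover have "a + 9 * nat (2 * maxk p) + 1 \<le> a + (18 * 4 ^ q + 1)"
    proof -
      have "nat (2 * maxk p) \<le> 2 * 4 ^ p" using maxk_less[of p] by linarith
      moreover have "(4::nat) ^ p \<le> 4 ^ q" using assms by (intro power_increasing) auto
      ultimately show ?thesis by linarith
    qed
    ultimately show "onehot (a + (18 * 4 ^ q + 1)) (\<lambda>x. foldl (clamp_add (- maxk p) (maxk p)) 0 (map (\<lambda>k. k x) ks))"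
      by (rule onehot_mono)
  qed
qed

text \<open>The base n + 2 absorbs constants into the exponent.\<close>

definition poly_bounded :: "(nat \<Rightarrow> nat) \<Rightarrow> bool" where
  "poly_bounded f \<longleftrightarrow> (\<exists>e. \<forall>n\<ge>1. f n \<le> (n + 2) ^ e)"

lemma poly_bounded_const: "poly_bounded (\<lambda>n. c)"
proof -
  have "c \<le> (n + 2) ^ c" for n
  proof -
    have "c \<le> 2 ^ c" by simp
    also have "(2::nat) ^ c \<le> (n + 2) ^ c" by (intro power_mono) auto
    finally show ?thesis .
  qed
  then show ?thesis unfolding poly_bounded_def by blast
qed

lemma poly_bounded_id: "poly_bounded (\<lambda>n. n)"
  unfolding poly_bounded_def by (intro exI[of _ 1]) simp

lemma poly_bounded_mult:
  assumes "poly_bounded f" "poly_bounded g"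
  shows "poly_bounded (\<lambda>n. f n * g n)"
proof -
  obtain c e where "\<forall>n\<ge>1. f n \<le> (n + 2) ^ c" "\<forall>n\<ge>1. g n \<le> (n + 2) ^ e"
    using assms unfolding poly_bounded_def by blast
  then have "\<forall>n\<ge>1. f n * g n \<le> (n + 2) ^ (c + e)"
    unfolding power_add by (auto intro: mult_mono)
  then show ?thesis unfolding poly_bounded_def by blast
qed

lemma poly_bounded_mono: "poly_bounded g \<Longrightarrow> (\<And>n. 1 \<le> n \<Longrightarrow> f n \<le> g n) \<Longrightarrow> poly_bounded f"
  unfolding poly_bounded_def by (meson le_trans)

lemma poly_bounded_add:
  assumes "poly_bounded f" "poly_bounded g"
  shows "poly_bounded (\<lambda>n. f n + g n)"
proof -
  have le: "f n + g n \<le> (f n + 1) * (g n + 1)" for n by (simp add: algebra_simps)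
  have "poly_bounded (\<lambda>n. h n + 1)" if "poly_bounded h" for h
  proof -
    obtain e where e: "\<forall>n\<ge>1. h n \<le> (n + 2) ^ e" using \<open>poly_bounded h\<close> unfolding poly_bounded_def by blast
    have "h n + 1 \<le> (n + 2) ^ Suc e" if "1 \<le> n" for n
    proof -
      have "1 \<le> (n + 2) ^ e" by simp
      then have "h n + 1 \<le> 2 * (n + 2) ^ e" using e that by (metis add_mono mult_2)
      also have "\<dots> \<le> (n + 2) ^ Suc e" by simp
      finally show ?thesis .
    qed
    then show ?thesis unfolding poly_bounded_def by blast
  qed
  from poly_bounded_mult[OF this[OF assms(1)] this[OF assms(2)]] show ?thesis
    by (rule poly_bounded_mono) (rule le)
qed

lemma poly_bounded_power: "poly_bounded f \<Longrightarrow> poly_bounded (\<lambda>n. f n ^ e)"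
  by (induction e) (auto intro: poly_bounded_mult poly_bounded_const[of 1, simplified])

lemmas poly_bounded_intros = poly_bounded_const poly_bounded_id poly_bounded_add poly_bounded_mult
  poly_bounded_power

lemma logpow_le_power: "1 \<le> n \<Longrightarrow> logpow k n \<le> real n ^ k"
proof -
  assume n: "1 \<le> n"
  have "real n < 2 ^ n" by (rule of_nat_less_two_power)
  then have "log 2 (real n) \<le> log 2 (2 ^ n)" using n by (subst log_le_cancel_iff) auto
  then have "log 2 (real n) \<le> real n" by simp
  then show ?thesis using n unfolding logpow_def by (intro power_mono) (auto simp: max_def)
qed

text \<open>Logarithmic precision means polynomially many representable numbers, hence one-hot codes
  of polynomial length.\<close>

lemma two_power_prec_le:
  assumes "1 \<le> n" "real p \<le> real c * logpow 1 n + real c"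
  shows "2 ^ p \<le> (n + 2) ^ (2 * c)"
proof -
  have lg: "logpow 1 n = log 2 (real n)" using assms(1) by (simp add: logpow_def max_def)
  have "real (2 ^ p) = 2 powr real p" by (simp add: powr_realpow)
  also have "\<dots> \<le> 2 powr (log 2 (real n) * real c + real c)"
    using assms(2) unfolding lg by (intro powr_mono) (auto simp: mult.commute)
  also have "\<dots> = real n ^ c * 2 ^ c"
    using assms(1) by (simp add: powr_add powr_realpow flip: powr_powr)
  also have "\<dots> \<le> real (n + 2) ^ c * real (n + 2) ^ c"
    by (intro mult_mono power_mono) auto
  also have "\<dots> = real ((n + 2) ^ (2 * c))" by (simp add: mult_2 power_add)
  finally show ?thesis by (simp only: of_nat_le_iff)
qed

text \<open>This serves both classes: \<open>s\<close> may be 1 or the logarithm, and the difference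
  lies in \<open>tf\<close>, where the depth \<open>A\<close> of a sum may depend on the constant
  \<open>c\<close> but not on \<open>n\<close>.\<close>

lemma loop_circuits:
  fixes s :: "nat \<Rightarrow> real"
  assumes L: "L \<in> Loop (logpow k) (\<lambda>n. real n ^ e) s"
    and s: "\<And>n. 1 \<le> n \<Longrightarrow> s n \<le> logpow 1 n + 1"
    and tf: "\<And>c. \<exists>A. \<forall>n p W Fs. 1 \<le> n \<longrightarrow> real p \<le> real c * s n + real c \<longrightarrow>
      tf_formulas b n ((W + 2 * 4 ^ p + 1)\<^sup>2) Fs p A W"
  shows "\<exists>c::nat. \<forall>n. \<exists>C. circ_wf n C \<and> (\<forall>gw\<in>set C. b \<or> ac_gate (fst gw))
       \<and> real (circ_size C) \<le> real c * real n ^ c + real c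
       \<and> real (circ_depth C) \<le> real c * logpow k n + real c
       \<and> (\<forall>x. length x = n \<longrightarrow> circ_out x C = L x)"
proof -
  obtain c :: nat where c: "\<forall>n\<ge>1. \<exists>Mo. lt_ok n Mo
       \<and> length (blk Mo) \<le> c \<and> (\<forall>La\<in>set (blk Mo). length (heads La) \<le> c)
       \<and> real (dim Mo) \<le> real c * real n ^ e + real c
       \<and> real (prec Mo) \<le> real c * s n + real c
       \<and> real (iters Mo) \<le> real c * logpow k n + real c
       \<and> (\<forall>x. length x = n \<longrightarrow> lt_out Mo x = L x)"
    using L unfolding Loop_def by blast
  define P where "P n Mo \<longleftrightarrow> lt_ok n Mo
       \<and> length (blk Mo) \<le> c \<and> (\<forall>La\<in>set (blk Mo). length (heads La) \<le> c)
       \<and> real (dim Mo) \<le> real c * real n ^ e + real c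
       \<and> real (prec Mo) \<le> real c * s n + real c
       \<and> real (iters Mo) \<le> real c * logpow k n + real c
       \<and> (\<forall>x. length x = n \<longrightarrow> lt_out Mo x = L x)" for n Mo
  \<comment> \<open>One model is fixed for each \<open>n\<close>, so that its parameters become
    functions of \<open>n\<close> to which \<open>poly_bounded\<close> applies.\<close>
  have "\<forall>n. \<exists>Mo. 1 \<le> n \<longrightarrow> P n Mo" using c unfolding P_def by blast
  from choice[OF this] obtain Mo where "\<And>n. 1 \<le> n \<Longrightarrow> P n (Mo n)" by blast
  then have Mo: "\<And>n. 1 \<le> n \<Longrightarrow> lt_ok n (Mo n)" "\<And>n. 1 \<le> n \<Longrightarrow> length (blk (Mo n)) \<le> c"
    "\<And>n. 1 \<le> n \<Longrightarrow> \<forall>La\<in>set (blk (Mo n)). length (heads La) \<le> c"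
    "\<And>n. 1 \<le> n \<Longrightarrow> real (dim (Mo n)) \<le> real c * real n ^ e + real c"
    "\<And>n. 1 \<le> n \<Longrightarrow> real (prec (Mo n)) \<le> real c * s n + real c"
    "\<And>n. 1 \<le> n \<Longrightarrow> real (iters (Mo n)) \<le> real c * logpow k n + real c"
    "\<And>n x. 1 \<le> n \<Longrightarrow> length x = n \<Longrightarrow> lt_out (Mo n) x = L x"
    unfolding P_def by blast+
  obtain A where A: "\<And>n p W Fs. 1 \<le> n \<Longrightarrow> real p \<le> real c * s n + real c \<Longrightarrow>
      tf_formulas b n ((W + 2 * 4 ^ p + 1)\<^sup>2) Fs p A W"
    using tf[of c] by blast
  define p where "p n = prec (Mo n)" for n
  define d where "d n = dim (Mo n)" for n
  define T where "T n = iters (Mo n) * length (blk (Mo n))" for n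
  define W where "W n = c + d n + n" for n
  define K where "K n = (W n + 2 * 4 ^ p n + 1)\<^sup>2" for n
  define S where "S n = (T n + 2) * ((n * (d n * (2 * 4 ^ p n)) + n + 1) * (K n + 2) ^ (23 + 7 * A)) + 2" for n
  have d: "poly_bounded d"
  proof (rule poly_bounded_mono)
    show "poly_bounded (\<lambda>n. c * n ^ e + c)" by (intro poly_bounded_intros)
    fix n :: nat assume "1 \<le> n"
    from Mo(4)[OF this] have "real (d n) \<le> real (c * n ^ e + c)" by (simp add: d_def)
    then show "d n \<le> c * n ^ e + c" by (simp only: of_nat_le_iff)
  qed
  have iters: "real (iters (Mo n)) * real (length (blk (Mo n))) \<le> (real c * logpow k n + real c) * real c"
    if "1 \<le> n" for n
    using Mo(2,6)[OF that] logpow_nonneg[of k n] by (intro mult_mono) auto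
  have T: "poly_bounded T"
  proof (rule poly_bounded_mono)
    show "poly_bounded (\<lambda>n. (c * n ^ k + c) * c)" by (intro poly_bounded_intros)
    fix n :: nat assume n: "1 \<le> n"
    have "(real c * logpow k n + real c) * real c \<le> (real c * real n ^ k + real c) * real c"
      using logpow_le_power[OF n, of k] by (intro mult_right_mono add_right_mono mult_left_mono) auto
    with iters[OF n] have "real (T n) \<le> real ((c * n ^ k + c) * c)" by (simp add: T_def)
    then show "T n \<le> (c * n ^ k + c) * c" by (simp only: of_nat_le_iff)
  qed
  have two_p: "poly_bounded (\<lambda>n. 2 ^ p n)"
    unfolding poly_bounded_def
  proof (intro exI allI impI)
    fix n :: nat assume n: "1 \<le> n"
    have "real c * s n + real c \<le> real c * (logpow 1 n + 1) + real c"
      using s[OF n] by (intro add_right_mono mult_left_mono) auto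
    also have "\<dots> \<le> real (2 * c) * logpow 1 n + real (2 * c)"
      using logpow_nonneg[of 1 n] by (simp add: algebra_simps)
    finally have "real (p n) \<le> real (2 * c) * logpow 1 n + real (2 * c)"
      using Mo(5)[OF n] by (simp add: p_def)
    from two_power_prec_le[OF n this] show "2 ^ p n \<le> (n + 2) ^ (2 * (2 * c))" .
  qed
  have "(4::nat) ^ q = (2 ^ q)\<^sup>2" for q 
    by (simp add: power2_eq_square flip: power_mult_distrib)
  then have four_p: "poly_bounded (\<lambda>n. 4 ^ p n)" using poly_bounded_power[OF two_p, of 2] by simp
  have W: "poly_bounded W" unfolding W_def by (intro poly_bounded_intros d)
  have "poly_bounded S"
    unfolding S_def K_def by (intro poly_bounded_intros d T W four_p)
  then obtain E where E: "\<And>n. 1 \<le> n \<Longrightarrow> S n \<le> (n + 2) ^ E" unfolding poly_bounded_def by blast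
  define a where "a = 23 + 7 * A"
  \<comment> \<open>This constant is both coefficient and exponent: \<open>3 ^ E\<close> comes from
    \<open>n + 2 \<le> 3 * n\<close> and is at least \<open>E\<close>; the other terms come from
    expanding the depth bound.\<close>
  define c' where "c' = 3 ^ E + a * c * c + 2 * a + 1"
  show ?thesis
  proof (intro exI[of _ c'] allI)
    fix n
    show "\<exists>C. circ_wf n C \<and> (\<forall>gw\<in>set C. b \<or> ac_gate (fst gw))
       \<and> real (circ_size C) \<le> real c' * real n ^ c' + real c'
       \<and> real (circ_depth C) \<le> real c' * logpow k n + real c'
       \<and> (\<forall>x. length x = n \<longrightarrow> circ_out x C = L x)"
    proof (cases "n = 0")
      case True
      \<comment> \<open>\<open>Loop\<close> has no model for length 0, so the answer to the empty
        input is hard-wired: an empty AND is true, an empty OR false.\<close>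
      define C :: circuit where "C = [(if L [] then GAnd else GOr, [])]"
      have 1: "1 \<le> real c'" by (simp add: c'_def)
      have "circ_size C = 1" "circ_depth C = 1"
        by (simp_all add: C_def circ_size_def circ_depth_def gate_depths_def)
      moreover have "circ_out [] C = L []"
        by (simp add: C_def circ_out_def circ_vals_def gate_val_def)
      moreover have "circ_wf 0 C" "\<forall>gw\<in>set C. b \<or> ac_gate (fst gw)"
        by (auto simp: C_def circ_wf_def ac_gate_def)
      ultimately show ?thesis using True 1 logpow_nonneg[of k 0]
        by (intro exI[of _ C]) (auto simp: add_increasing)
    next
      case False
      then have n: "1 \<le> n" by simp
      have "\<forall>La\<in>set (blk (Mo n)). length (heads La) \<le> W n" "d n \<le> W n" "n \<le> W n"
        using Mo(3)[OF n] by (auto simp: W_def)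
      from looped_tf_circuit[OF n Mo(1)[OF n] this(1) this(2,3)[unfolded d_def] A[OF n Mo(5)[OF n]]]
      obtain C where C: "circ_wf n C" "\<forall>gw\<in>set C. b \<or> ac_gate (fst gw)" "circ_size C \<le> S n"
        "circ_depth C \<le> a * (T n + 2) + 1" "\<forall>x. length x = n \<longrightarrow> circ_out x C = lt_out (Mo n) x"
        unfolding S_def K_def T_def p_def d_def a_def by blast
      have "circ_size C \<le> (n + 2) ^ E" using C(3) E[OF n] by linarith
      also have "\<dots> \<le> (3 * n) ^ E" using n by (intro power_mono) auto
      also have "\<dots> = 3 ^ E * n ^ E" by (rule power_mult_distrib)
      also have "\<dots> \<le> c' * n ^ c'"
      proof (intro mult_mono power_increasing)
        have "E \<le> 2 ^ E" by simp
        also have "(2::nat) ^ E \<le> 3 ^ E" by (intro power_mono) auto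
        finally have "E \<le> 3 ^ E" .
        then show "E \<le> c'" unfolding c'_def by linarith
      qed (use n in \<open>auto simp: c'_def\<close>)
      finally have "real (circ_size C) \<le> real (c' * n ^ c')" by (simp only: of_nat_le_iff)
      then have size: "real (circ_size C) \<le> real c' * real n ^ c' + real c'" by simp
      have "real (circ_depth C) \<le> real (a * (T n + 2) + 1)"
        using C(4) by (simp only: of_nat_le_iff)
      then have "real (circ_depth C) \<le> real a * (real (T n) + 2) + 1" by (simp add: algebra_simps)
      also have "\<dots> \<le> real a * ((real c * logpow k n + real c) * real c + 2) + 1"
        using iters[OF n] by (intro add_right_mono mult_left_mono) (auto simp: T_def)
      also have "\<dots> = real (a * c * c) * logpow k n + real (a * c * c + 2 * a + 1)"
        by (simp add: algebra_simps)
      also have "\<dots> \<le> real c' * logpow k n + real c'"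
        by (intro add_mono mult_right_mono logpow_nonneg) (auto simp: c'_def)
      finally show ?thesis using C Mo(7)[OF n] size by (intro exI[of _ C]) auto
    qed
  qed
qed

theorem mainTheorem3:
  fixes k :: nat
  shows "(\<Union>e. Loop (logpow k) (\<lambda>n. real n ^ e) (\<lambda>n. 1)) = AC k
       \<and> (\<Union>e. Loop (logpow k) (\<lambda>n. real n ^ e) (logpow 1)) = TC k"
proof (intro conjI equalityI subsetI)
  fix L assume "L \<in> (\<Union>e. Loop (logpow k) (\<lambda>n. real n ^ e) (\<lambda>n. 1))"
  then obtain e where L: "L \<in> Loop (logpow k) (\<lambda>n. real n ^ e) (\<lambda>n. 1)" by blast
  \<comment> \<open>The precision is at most \<open>2 * c\<close> for every \<open>n\<close>, which
    gives the uniform bound \<open>q\<close>.\<close>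
  have "\<exists>A. \<forall>n p W Fs. 1 \<le> n \<longrightarrow> real p \<le> real c * 1 + real c \<longrightarrow>
      tf_formulas False n ((W + 2 * 4 ^ p + 1)\<^sup>2) Fs p A W" for c :: nat
    by (intro exI[of _ "18 * 4 ^ (2 * c) + 1"] allI impI tf_formulas_unbounded_fanin) linarith
  from loop_circuits[OF L _ this] show "L \<in> AC k"
    by (simp add: AC_def logpow_nonneg)
next
  fix L assume "L \<in> (\<Union>e. Loop (logpow k) (\<lambda>n. real n ^ e) (logpow 1))"
  then obtain e where L: "L \<in> Loop (logpow k) (\<lambda>n. real n ^ e) (logpow 1)" by blast
  have "\<exists>A. \<forall>n p W Fs. 1 \<le> n \<longrightarrow> real p \<le> real c * logpow 1 n + real c \<longrightarrow>
      tf_formulas True n ((W + 2 * 4 ^ p + 1)\<^sup>2) Fs p A W" for c :: nat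
    by (intro exI[of _ 7] allI impI tf_formulas_threshold)
  from loop_circuits[OF L _ this] show "L \<in> TC k"
    by (simp add: TC_def)
next
  fix L assume "L \<in> AC k"
  from AC_subset_Loop[OF this] show "L \<in> (\<Union>e. Loop (logpow k) (\<lambda>n. real n ^ e) (\<lambda>n. 1))"
    by (simp only: UN_iff UNIV_I bex_UNIV)
next
  fix L assume "L \<in> TC k"
  from TC_subset_Loop[OF this] show "L \<in> (\<Union>e. Loop (logpow k) (\<lambda>n. real n ^ e) (logpow 1))"
    by (simp only: UN_iff UNIV_I bex_UNIV)
qed

end
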